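(* Let $q=2^e$ with $e>2$. Let $P$ and $Q$ be the two maximal parabolic subgroups of $\mathrm{Sp}_4(q)$, namely the stabilizer of a $1$-dimensional subspace and the stabilizer of a totally isotropic $2$-dimensional subspace of $\mathbb{F}_q^4$; each is isomorphic to $E_q^3\rtimes\mathrm{GL}_2(q)$ and has order $q^3(q^2+q)(q-1)^2$. Then neither $(\mathrm{Sp}_4(q),P)$ nor $(\mathrm{Sp}_4(q),Q)$ is a strong Gelfand pair.
   Context: All characters are complex. A pair $(G,H)$ with $H\le G$ finite is a strong Gelfand pair if for every irreducible character $\psi$ of $H$, the induced character $\psi\uparrow G$ satisfies $\langle \psi\uparrow G,\chi\rangle\le 1$ for every irreducible character $\chi$ of $G$. $\mathrm{Sp}_4(q)$ is the symplectic group of a nondegenerate alternating form on $\mathbb{F}_q^4$. $E_q^3$ denotes an elementary abelian group of order $q^3$. *)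

theory Defs
  imports "Jordan_Normal_Form.Matrix" "HOL-Algebra.Group"
begin

definition mat_trace :: "'a::comm_ring_1 mat \<Rightarrow> 'a" where
  "mat_trace A = (\<Sum>i<dim_row A. A $$ (i,i))"

definition representation :: "('g,'b) monoid_scheme \<Rightarrow> nat \<Rightarrow> ('g \<Rightarrow> complex mat) \<Rightarrow> bool" where
  "representation G n \<rho> \<longleftrightarrow> n > 0 \<and>
     (\<forall>g\<in>carrier G. \<rho> g \<in> carrier_mat n n) \<and>
     \<rho> \<one>\<^bsub>G\<^esub> = 1\<^sub>m n \<and>
     (\<forall>g\<in>carrier G. \<forall>h\<in>carrier G. \<rho> (g \<otimes>\<^bsub>G\<^esub> h) = \<rho> g * \<rho> h)"

definition invariant_subspace :: "('g,'b) monoid_scheme \<Rightarrow> nat \<Rightarrow> ('g \<Rightarrow> complex mat) \<Rightarrow> complex vec set \<Rightarrow> bool" where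
  "invariant_subspace G n \<rho> W \<longleftrightarrow> W \<subseteq> carrier_vec n \<and> 0\<^sub>v n \<in> W \<and>
     (\<forall>x\<in>W. \<forall>y\<in>W. x + y \<in> W) \<and> (\<forall>c. \<forall>x\<in>W. c \<cdot>\<^sub>v x \<in> W) \<and>
     (\<forall>g\<in>carrier G. \<forall>x\<in>W. \<rho> g *\<^sub>v x \<in> W)"

definition irreducible_rep :: "('g,'b) monoid_scheme \<Rightarrow> nat \<Rightarrow> ('g \<Rightarrow> complex mat) \<Rightarrow> bool" where
  "irreducible_rep G n \<rho> \<longleftrightarrow> representation G n \<rho> \<and>
     (\<forall>W. invariant_subspace G n \<rho> W \<longrightarrow> W = {0\<^sub>v n} \<or> W = carrier_vec n)"

definition irr_char :: "('g,'b) monoid_scheme \<Rightarrow> ('g \<Rightarrow> complex) \<Rightarrow> bool" where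
  "irr_char G \<chi> \<longleftrightarrow> (\<exists>n \<rho>. irreducible_rep G n \<rho> \<and> (\<forall>g\<in>carrier G. \<chi> g = mat_trace (\<rho> g)))"

definition char_inner :: "('g,'b) monoid_scheme \<Rightarrow> ('g \<Rightarrow> complex) \<Rightarrow> ('g \<Rightarrow> complex) \<Rightarrow> complex" where
  "char_inner G \<chi> \<psi> = (\<Sum>g\<in>carrier G. \<chi> g * cnj (\<psi> g)) / of_nat (card (carrier G))"

definition induced_char :: "('g,'b) monoid_scheme \<Rightarrow> 'g set \<Rightarrow> ('g \<Rightarrow> complex) \<Rightarrow> 'g \<Rightarrow> complex" where
  "induced_char G H \<psi> g = (\<Sum>x\<in>carrier G.
      if x \<otimes>\<^bsub>G\<^esub> g \<otimes>\<^bsub>G\<^esub> inv\<^bsub>G\<^esub> x \<in> H then \<psi> (x \<otimes>\<^bsub>G\<^esub> g \<otimes>\<^bsub>G\<^esub> inv\<^bsub>G\<^esub> x) else 0)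
      / of_nat (card H)"

definition strong_gelfand_pair :: "('g,'b) monoid_scheme \<Rightarrow> 'g set \<Rightarrow> bool" where
  "strong_gelfand_pair G H \<longleftrightarrow>
     (\<forall>\<psi>. irr_char (G\<lparr>carrier := H\<rparr>) \<psi> \<longrightarrow>
        (\<forall>\<chi>. irr_char G \<chi> \<longrightarrow> Re (char_inner G (induced_char G H \<psi>) \<chi>) \<le> 1))"

text \<open>Standard alternating form on F^4 with basis e1,e2,f1,f2: B(x,y) = x^T J y.\<close>
definition J4 :: "'a::field mat" where
  "J4 = mat 4 4 (\<lambda>(i,j). if j = i + 2 then 1 else if i = j + 2 then -1 else 0)"

definition sform :: "'a::field vec \<Rightarrow> 'a vec \<Rightarrow> 'a" where
  "sform x y = x \<bullet> (J4 *\<^sub>v y)"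

definition Sp4 :: "'a::field mat monoid" where
  "Sp4 = \<lparr>carrier = {A \<in> carrier_mat 4 4. transpose_mat A * J4 * A = J4},
          mult = (*), one = 1\<^sub>m 4\<rparr>"

definition stabilizer :: "'a::field vec set \<Rightarrow> 'a mat set" where
  "stabilizer W = {A \<in> carrier (Sp4 :: 'a mat monoid). (\<lambda>x. A *\<^sub>v x) ` W = W}"

definition span1 :: "'a::field vec \<Rightarrow> 'a vec set" where
  "span1 v = {c \<cdot>\<^sub>v v | c. True}"

definition span2 :: "'a::field vec \<Rightarrow> 'a vec \<Rightarrow> 'a vec set" where
  "span2 u w = {a \<cdot>\<^sub>v u + b \<cdot>\<^sub>v w | a b. True}"

end

theory Submission
  imports Defs "HOL-Algebra.Multiplicative_Group" "Jordan_Normal_Form.VS_Connect"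
    "HOL-Library.Product_Plus" "HOL-Number_Theory.Residues"
begin

text \<open>
  Irreducible characters of $G = \mathrm{Sp}_4(q)$ and of a parabolic $H$ are produced by inducing linear
  characters $\nu$ of a Borel subgroup $B$ of $G$ and $\mu$ of a subgroup $K \le H$, where $K$ is the unipotent
  radical of $H$ extended by a split torus of order $q - 1$. Both are irreducible by Mackey's criterion. The
  multiplicity of $\mathrm{Ind}_B^G \nu$ in $(\mathrm{Ind}_K^H \mu)\uparrow G = \mathrm{Ind}_K^G \mu$ is
  the number of double cosets $B y K$ on which $\nu^y$ and $\mu$ agree, so it is enough to exhibit two of them:
  the big cell, when the restrictions of $\mu$ and $\nu$ to the torus match, and a double coset with
  $K \cap B^y = 1$. The torus characters are powers $\theta, \theta^2$ of a faithful character of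
  $\mathbb{F}_q^\times$; regularity needs $\theta^2, \theta^3, \theta^4 \ne 1$, hence $q > 4$.
\<close>

section \<open>Induced linear characters\<close>

text \<open>The shape of K comes from the character of the unipotent radical: it is \<phi> of a
  split coordinate, and its stabilizer in the Levi factor is the dihedral group of order 2(q - 1), a
  torus extended by a swap that inverts it. K keeps only the torus; the swap is ruled out because
  \<theta> differs from its inverse even up to a sign. The exponents in \<nu> come from the big
  cell. There K meets B in this torus, on which the pair (\<theta>1, \<theta>2) restricts to
  \<theta>2 / \<theta>1 for a plane and to \<theta>2 for a line, and this has to be \<theta>. The
  pairs (\<theta>, \<theta>^2) and (\<theta>^2, \<theta>) achieve it and are regular under the Weyl
  group of type C2. Characteristic 2 enters in three ways: the radical of a line stabilizer is
  abelian, \<phi> takes only signs as values, and the second double coset leaves only torus elements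
  with t = 1 / t, which now means t = 1.\<close>

definition zero_ext :: "'g set \<Rightarrow> ('g \<Rightarrow> complex) \<Rightarrow> 'g \<Rightarrow> complex" where
  "zero_ext K \<mu> x = (if x \<in> K then \<mu> x else 0)"

locale finite_group = group G for G (structure) +
  assumes finite_carrier: "finite (carrier G)"
begin

lemma finite_subgroup: "subgroup K G \<Longrightarrow> finite K"
  using finite_carrier finite_subset subgroup.subset by blast

lemma card_subgroup_pos: "subgroup K G \<Longrightarrow> card K > 0"
  using finite_subgroup subgroup.one_closed by (metis card_gt_0_iff empty_iff)

lemma bij_conj: "a \<in> carrier G \<Longrightarrow> bij_betw (\<lambda>x. a \<otimes> x \<otimes> inv a) (carrier G) (carrier G)"
proof -
  assume a: "a \<in> carrier G"
  have "inv a \<otimes> (a \<otimes> x) = x" "a \<otimes> (inv a \<otimes> x) = x" if "x \<in> carrier G" for x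
    using a that by (simp_all add: m_assoc[symmetric])
  then show ?thesis using a
    by (intro bij_betw_byWitness[where f' = "\<lambda>x. inv a \<otimes> x \<otimes> a"]) (auto simp: m_assoc)
qed

lemma bij_mult_right: "a \<in> carrier G \<Longrightarrow> bij_betw (\<lambda>x. x \<otimes> a) (carrier G) (carrier G)"
  by (rule bij_betw_byWitness[where f' = "\<lambda>x. x \<otimes> inv a"]) (auto simp: m_assoc)

lemma bij_subgroup_mult_left:
  assumes "subgroup K G" "a \<in> K" shows "bij_betw (\<lambda>x. a \<otimes> x) K K"
proof (rule bij_betw_byWitness[where f' = "\<lambda>x. inv a \<otimes> x"])
  have c: "\<And>x. x \<in> K \<Longrightarrow> x \<in> carrier G" using assms subgroup.subset by blast
  show "\<forall>x\<in>K. inv a \<otimes> (a \<otimes> x) = x" "\<forall>x\<in>K. a \<otimes> (inv a \<otimes> x) = x"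
    using c assms(2) by (simp_all add: m_assoc[symmetric])
  show "(\<otimes>) a ` K \<subseteq> K" "(\<otimes>) (inv a) ` K \<subseteq> K"
    using assms by (auto intro: subgroup.m_closed subgroup.m_inv_closed)
qed

end

locale linear_character = finite_group +
  fixes K :: "'a set" and \<mu> :: "'a \<Rightarrow> complex"
  assumes sub: "subgroup K G"
    and char_one: "\<mu> \<one> = 1"
    and char_mult: "\<And>x y. x \<in> K \<Longrightarrow> y \<in> K \<Longrightarrow> \<mu> (x \<otimes> y) = \<mu> x * \<mu> y"
begin

lemma carr: "x \<in> K \<Longrightarrow> x \<in> carrier G" using sub subgroup.subset by blast

lemma closed [simp]:
  "\<one> \<in> K" "x \<in> K \<Longrightarrow> y \<in> K \<Longrightarrow> x \<otimes> y \<in> K" "x \<in> K \<Longrightarrow> inv x \<in> K"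
  using sub by (auto intro: subgroup.one_closed subgroup.m_closed subgroup.m_inv_closed)

lemma mult_mem_left: "x \<in> carrier G \<Longrightarrow> b \<in> K \<Longrightarrow> b \<otimes> x \<in> K \<longleftrightarrow> x \<in> K"
  by (metis carr closed(2,3) inv_solve_left m_closed)

lemma mult_mem_right: "x \<in> carrier G \<Longrightarrow> b \<in> K \<Longrightarrow> x \<otimes> b \<in> K \<longleftrightarrow> x \<in> K"
  by (metis carr closed(2,3) inv_solve_right m_closed)

lemma char_inv_left: "x \<in> K \<Longrightarrow> \<mu> (inv x) * \<mu> x = 1"
  using char_mult[of "inv x" x] carr char_one by simp

lemma char_nonzero: "x \<in> K \<Longrightarrow> \<mu> x \<noteq> 0"
  using char_inv_left by fastforce

lemma char_inv: "x \<in> K \<Longrightarrow> \<mu> (inv x) = inverse (\<mu> x)"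
  using char_inv_left[of x] char_nonzero[of x] by (simp add: field_simps)

lemma char_pow: "x \<in> K \<Longrightarrow> x [^] n \<in> K \<and> \<mu> (x [^] n) = \<mu> x ^ n" for n :: nat
  by (induction n) (auto simp: char_one char_mult)

lemma char_norm: assumes "x \<in> K" shows "cmod (\<mu> x) = 1"
proof -
  have "\<mu> x ^ Coset.order G = 1"
    using char_pow[OF assms, of "Coset.order G"] pow_order_eq_1[of x] carr[OF assms] char_one by simp
  then have "cmod (\<mu> x) ^ Coset.order G = 1" by (metis norm_one norm_power)
  moreover have "Coset.order G > 0" using finite_carrier by (simp add: order_gt_0_iff_finite)
  ultimately show ?thesis using power_eq_iff_eq_base[of "Coset.order G" "cmod (\<mu> x)" 1] by simp
qed

lemma cnj_char: assumes "x \<in> K" shows "cnj (\<mu> x) = inverse (\<mu> x)"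
proof -
  have "\<mu> x * cnj (\<mu> x) = 1"
    using complex_norm_square[of "\<mu> x"] char_norm[OF assms] by simp
  then show ?thesis by (rule inverse_unique[symmetric])
qed

lemma zero_ext_mult_left:
  "x \<in> carrier G \<Longrightarrow> b \<in> K \<Longrightarrow> zero_ext K \<mu> (b \<otimes> x) = \<mu> b * zero_ext K \<mu> x"
  by (simp add: zero_ext_def mult_mem_left char_mult)

lemma zero_ext_mult_right:
  "x \<in> carrier G \<Longrightarrow> b \<in> K \<Longrightarrow> zero_ext K \<mu> (x \<otimes> b) = zero_ext K \<mu> x * \<mu> b"
  by (simp add: zero_ext_def mult_mem_right char_mult)

lemma zero_ext_conj:
  "x \<in> carrier G \<Longrightarrow> b \<in> K \<Longrightarrow> zero_ext K \<mu> (b \<otimes> x \<otimes> inv b) = zero_ext K \<mu> x"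
  using carr char_nonzero[of b] by (simp add: zero_ext_mult_left zero_ext_mult_right char_inv)

text \<open>Translation by d multiplies the sum by \<open>\<mu> d\<close>, so a single nontrivial
  value makes it vanish.\<close>

lemma sum_char:
  "(\<Sum>x\<in>K. \<mu> x) = (if \<forall>x\<in>K. \<mu> x = 1 then of_nat (card K) else 0)"
proof (cases "\<forall>x\<in>K. \<mu> x = 1")
  case False
  then obtain d where d: "d \<in> K" "\<mu> d \<noteq> 1" by blast
  have "(\<Sum>x\<in>K. \<mu> x) = (\<Sum>x\<in>K. \<mu> (d \<otimes> x))"
    using sum.reindex_bij_betw[OF bij_subgroup_mult_left[OF sub d(1)], of \<mu>] by simp
  also have "\<dots> = \<mu> d * (\<Sum>x\<in>K. \<mu> x)"
    using d by (simp add: char_mult sum_distrib_left)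
  finally have "(1 - \<mu> d) * (\<Sum>x\<in>K. \<mu> x) = 0" by (simp add: algebra_simps)
  then show ?thesis using d False by auto
qed simp

end

section \<open>Monomial representations and Mackey's irreducibility criterion\<close>

lemma induced_char_zero_ext:
  "induced_char G K \<mu> g = (\<Sum>x\<in>carrier G. zero_ext K \<mu> (x \<otimes>\<^bsub>G\<^esub> g \<otimes>\<^bsub>G\<^esub> inv\<^bsub>G\<^esub> x)) / of_nat (card K)"
  unfolding induced_char_def zero_ext_def ..

text \<open>Mackey's criterion for a linear character: \<mu> and its conjugate by g differ on the
  part of K that g conjugates into K. H is a separate argument so that conjugation in one ambient
  group serves for G and for a parabolic subgroup alike.\<close>

definition mackey_irreducible :: "('g,'b) monoid_scheme \<Rightarrow> 'g set \<Rightarrow> 'g set \<Rightarrow> ('g \<Rightarrow> complex) \<Rightarrow> bool" where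
  "mackey_irreducible G H K \<mu> \<longleftrightarrow> (\<forall>g\<in>H - K. \<exists>u\<in>K.
     g \<otimes>\<^bsub>G\<^esub> u \<otimes>\<^bsub>G\<^esub> inv\<^bsub>G\<^esub> g \<in> K \<and> \<mu> (g \<otimes>\<^bsub>G\<^esub> u \<otimes>\<^bsub>G\<^esub> inv\<^bsub>G\<^esub> g) \<noteq> \<mu> u)"

text \<open>Stated by coordinates, so that the combination is an ordinary sum of complex numbers. It
  serves for averaging over K and for expanding a vector in a basis.\<close>

lemma invariant_subspace_combination:
  assumes W: "invariant_subspace G n \<rho> W" and "finite A" and "\<And>a. a \<in> A \<Longrightarrow> v a \<in> W"
  shows "\<exists>s\<in>W. \<forall>i<n. s $ i = (\<Sum>a\<in>A. c a * v a $ i)"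
  using assms(2,3)
proof (induction A rule: finite_induct)
  case empty
  then show ?case using W unfolding invariant_subspace_def by (intro bexI[of _ "0\<^sub>v n"]) auto
next
  case (insert x F)
  then obtain s where s: "s \<in> W" "\<forall>i<n. s $ i = (\<Sum>a\<in>F. c a * v a $ i)" by auto
  have "c x \<cdot>\<^sub>v v x + s \<in> W" using W insert.prems s(1) unfolding invariant_subspace_def by blast
  moreover have "dim_vec s = n" "dim_vec (v x) = n"
    using W s(1) insert.prems unfolding invariant_subspace_def by (auto simp: subset_iff)
  ultimately show ?case using insert.hyps s(2) by (intro bexI[of _ "c x \<cdot>\<^sub>v v x + s"]) auto
qed

context linear_character
begin

text \<open>Right coset representatives, found as a maximal set of pairwise inequivalent elements
  among the sets containing \<one>. The normalisation \<open>t 0 = \<one>\<close> makes coordinate 0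
  the trivial coset.\<close>

lemma transversal:
  obtains n :: nat and t where "n > 0" "t 0 = \<one>" "\<And>i. i < n \<Longrightarrow> t i \<in> carrier G"
    "\<And>g. g \<in> carrier G \<Longrightarrow> \<exists>!i. i < n \<and> g \<otimes> inv (t i) \<in> K"
proof -
  define S where "S = {T. \<one> \<in> T \<and> T \<subseteq> carrier G \<and> (\<forall>x\<in>T. \<forall>y\<in>T. x \<otimes> inv y \<in> K \<longrightarrow> x = y)}"
  have "S \<subseteq> Pow (carrier G)" by (auto simp: S_def)
  then have "finite S" using finite_carrier by (meson finite_Pow_iff finite_subset)
  moreover have "{\<one>} \<in> S" by (simp add: S_def)
  ultimately obtain T where T: "T \<in> S" and max: "\<And>T'. T' \<in> S \<Longrightarrow> T \<subseteq> T' \<Longrightarrow> T' = T"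
    using finite_has_maximal2[of S "{\<one>}"] by auto
  have Tc: "T \<subseteq> carrier G" and T1: "\<one> \<in> T"
    and Tinj: "\<And>x y. x \<in> T \<Longrightarrow> y \<in> T \<Longrightarrow> x \<otimes> inv y \<in> K \<Longrightarrow> x = y" using T by (auto simp: S_def)
  have flip: "y \<otimes> inv x \<in> K" if "x \<otimes> inv y \<in> K" "x \<in> carrier G" "y \<in> carrier G" for x y
    using closed(3)[OF that(1)] that by (simp add: inv_mult_group)
  have ex: "\<exists>x\<in>T. g \<otimes> inv x \<in> K" if g: "g \<in> carrier G" for g
  proof (rule ccontr)
    assume n: "\<not> ?thesis"
    then have "\<forall>x\<in>T. x \<otimes> inv g \<notin> K" using flip g Tc by blast
    then have "insert g T \<in> S" using n T g by (auto simp: S_def)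
    then have "g \<in> T" using max by blast
    then show False using n g by force
  qed
  have uniq: "x = y" if "g \<in> carrier G" "x \<in> T" "y \<in> T" "g \<otimes> inv x \<in> K" "g \<otimes> inv y \<in> K" for g x y
  proof (rule Tinj[OF that(2,3)])
    have c: "x \<in> carrier G" "y \<in> carrier G" using Tc that by auto
    have "(x \<otimes> inv g) \<otimes> (g \<otimes> inv y) \<in> K" using flip[OF that(4)] that c by auto
    moreover have "inv g \<otimes> (g \<otimes> inv y) = inv y" using c that(1) by (simp add: m_assoc[symmetric])
    ultimately show "x \<otimes> inv y \<in> K" using c that(1) by (simp add: m_assoc)
  qed
  have "finite (T - {\<one>})" using Tc finite_carrier finite_subset by blast
  then obtain xs where xs: "set xs = T - {\<one>}" "distinct xs" using finite_distinct_list by blast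
  define ts where "ts = \<one> # xs"
  have ts: "distinct ts" "set ts = T" using xs T1 by (auto simp: ts_def)
  show thesis
  proof (rule that[of "length ts" "\<lambda>i. ts ! i"])
    show "0 < length ts" "ts ! 0 = \<one>" by (simp_all add: ts_def)
    show "ts ! i \<in> carrier G" if "i < length ts" for i using ts Tc that nth_mem by blast
    show "\<exists>!i. i < length ts \<and> g \<otimes> inv (ts ! i) \<in> K" if g: "g \<in> carrier G" for g
    proof -
      obtain x where "x \<in> T" "g \<otimes> inv x \<in> K" using ex[OF g] by blast
      then obtain i where "i < length ts" "g \<otimes> inv (ts ! i) \<in> K" using ts by (metis in_set_conv_nth)
      then show ?thesis using uniq[OF g] ts nth_mem by (metis nth_eq_iff_index_eq)
    qed
  qed
qed

text \<open>An invariant subspace is moved to have nonzero coordinate at the trivial coset and then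
  projected onto the $\mu$-eigenspace of $K$; Mackey's condition makes that eigenspace the line
  spanned by the basis vector of the trivial coset, which generates everything.\<close>

theorem irr_char_induced_char:
  assumes mackey: "mackey_irreducible G (carrier G) K \<mu>"
  shows "irr_char G (induced_char G K \<mu>)"
proof -
  obtain n :: nat and t where n: "n > 0" and t0: "t 0 = \<one>" and tc: "\<And>i. i < n \<Longrightarrow> t i \<in> carrier G"
    and ex1: "\<And>g. g \<in> carrier G \<Longrightarrow> \<exists>!i. i < n \<and> g \<otimes> inv (t i) \<in> K"
    using transversal by blast
  let ?z = "zero_ext K \<mu>"
  \<comment> \<open>The induced representation on the cosets \<open>K t i\<close>: row i of
    \<open>\<rho> g\<close> has its only nonzero entry at the coset of
    \<open>t i \<otimes> g\<close>, which is how \<open>row\<close> evaluates sums.\<close>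
  define \<rho> where "\<rho> g = mat n n (\<lambda>(i,j). ?z (t i \<otimes> g \<otimes> inv (t j)))" for g
  have row: "(\<Sum>k<n. ?z (g \<otimes> inv (t k)) * F k) = \<mu> (g \<otimes> inv (t k0)) * F k0"
    if g: "g \<in> carrier G" and k0: "k0 < n" "g \<otimes> inv (t k0) \<in> K" for g k0 F
  proof -
    have "(\<Sum>k<n. ?z (g \<otimes> inv (t k)) * F k) = (\<Sum>k\<in>{k0}. ?z (g \<otimes> inv (t k)) * F k)"
      using ex1[OF g] k0 by (intro sum.mono_neutral_right) (auto simp: zero_ext_def)
    then show ?thesis using k0 by (simp add: zero_ext_def)
  qed
  have diag: "t i \<otimes> inv (t j) \<in> K \<longleftrightarrow> i = j" if "i < n" "j < n" for i j
  proof -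
    have "t i \<otimes> inv (t i) \<in> K" using tc[OF that(1)] by simp
    then show ?thesis using ex1[OF tc[OF that(1)]] that by blast
  qed
  have act: "(\<rho> g *\<^sub>v w) $ i = (\<Sum>k<n. ?z (t i \<otimes> g \<otimes> inv (t k)) * w $ k)"
    if "i < n" "w \<in> carrier_vec n" for g w i
    using that by (simp add: \<rho>_def scalar_prod_def atLeast0LessThan)
  have dim: "\<rho> g \<in> carrier_mat n n" for g by (simp add: \<rho>_def)
  have mult: "\<rho> (g \<otimes> h) = \<rho> g * \<rho> h" if gh: "g \<in> carrier G" "h \<in> carrier G" for g h
  proof (rule eq_matI)
    fix i j assume "i < dim_row (\<rho> g * \<rho> h)" "j < dim_col (\<rho> g * \<rho> h)"
    then have ij: "i < n" "j < n" using dim by (auto simp: \<rho>_def)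
    have c: "t i \<otimes> g \<in> carrier G" using tc ij gh by simp
    obtain k where k: "k < n" "t i \<otimes> g \<otimes> inv (t k) \<in> K" using ex1[OF c] by blast
    have kc: "t k \<in> carrier G" "t i \<in> carrier G" "t j \<in> carrier G" using tc k ij by auto
    have "(\<rho> g * \<rho> h) $$ (i,j) = (\<Sum>k<n. ?z (t i \<otimes> g \<otimes> inv (t k)) * ?z (t k \<otimes> h \<otimes> inv (t j)))"
      using ij by (simp add: \<rho>_def scalar_prod_def atLeast0LessThan)
    also have "\<dots> = \<mu> (t i \<otimes> g \<otimes> inv (t k)) * ?z (t k \<otimes> h \<otimes> inv (t j))"
      by (rule row[OF c k])
    also have "\<dots> = ?z ((t i \<otimes> g \<otimes> inv (t k)) \<otimes> (t k \<otimes> h \<otimes> inv (t j)))"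
      using k(2) kc gh by (subst zero_ext_mult_left) auto
    also have "(t i \<otimes> g \<otimes> inv (t k)) \<otimes> (t k \<otimes> h \<otimes> inv (t j)) = t i \<otimes> (g \<otimes> h) \<otimes> inv (t j)"
    proof -
      have "inv (t k) \<otimes> (t k \<otimes> (h \<otimes> inv (t j))) = h \<otimes> inv (t j)"
        using kc gh by (simp add: m_assoc[symmetric])
      then show ?thesis using kc gh by (simp add: m_assoc)
    qed
    finally show "\<rho> (g \<otimes> h) $$ (i,j) = (\<rho> g * \<rho> h) $$ (i,j)" using ij by (simp add: \<rho>_def)
  qed (auto simp: \<rho>_def)
  have one: "\<rho> \<one> = 1\<^sub>m n"
    using diag tc char_one by (intro eq_matI) (auto simp: \<rho>_def zero_ext_def)
  have rep: "representation G n \<rho>"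
    unfolding representation_def using n dim one mult by blast
  have irred: "W = {0\<^sub>v n} \<or> W = carrier_vec n" if W: "invariant_subspace G n \<rho> W" for W
  proof (cases "W = {0\<^sub>v n}")
    case False
    have Wc: "W \<subseteq> carrier_vec n" and Wact: "\<And>g w. g \<in> carrier G \<Longrightarrow> w \<in> W \<Longrightarrow> \<rho> g *\<^sub>v w \<in> W"
      and Wsmult: "\<And>c w. w \<in> W \<Longrightarrow> c \<cdot>\<^sub>v w \<in> W" and W0: "0\<^sub>v n \<in> W"
      using W unfolding invariant_subspace_def by blast+
    obtain w where w: "w \<in> W" "w \<noteq> 0\<^sub>v n" using False W0 by blast
    have wc: "w \<in> carrier_vec n" using w Wc by blast
    obtain j where j: "j < n" "w $ j \<noteq> 0"
    proof (rule ccontr)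
      assume "\<not> thesis"
      then have "\<forall>j<n. w $ j = 0" using that by blast
      then have "w = 0\<^sub>v n" using wc by (intro eq_vecI) auto
      then show False using w by blast
    qed
    \<comment> \<open>Since \<open>t 0 = \<one>\<close>, row 0 of \<open>\<rho> (t j)\<close> reads
      off coordinate j.\<close>
    define w1 where "w1 = \<rho> (t j) *\<^sub>v w"
    have w1: "w1 \<in> W" using Wact[OF tc[OF j(1)] w(1)] by (simp add: w1_def)
    have w1c: "w1 \<in> carrier_vec n" using w1 Wc by blast
    have "w1 $ 0 = w $ j"
    proof -
      have "w1 $ 0 = (\<Sum>k<n. ?z (t j \<otimes> inv (t k)) * w $ k)"
        unfolding w1_def using act[OF n wc] tc[OF j(1)] by (simp add: t0)
      also have "\<dots> = w $ j" using row[OF tc[OF j(1)] j(1)] tc[OF j(1)] char_one by simp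
      finally show ?thesis .
    qed
    then have w10: "w1 $ 0 \<noteq> 0" using j by simp
    obtain s where s: "s \<in> W" "\<forall>i<n. s $ i = (\<Sum>b\<in>K. \<mu> (inv b) * (\<rho> b *\<^sub>v w1) $ i)"
      using invariant_subspace_combination[OF W finite_subgroup[OF sub], of "\<lambda>b. \<rho> b *\<^sub>v w1" "\<lambda>b. \<mu> (inv b)"]
        Wact w1 carr by blast
    have sc: "s \<in> carrier_vec n" using s Wc by blast
    have eigen: "(\<rho> u *\<^sub>v s) $ i = \<mu> u * s $ i" if u: "u \<in> K" and i: "i < n" for u i
    proof -
      have "(\<rho> u *\<^sub>v s) $ i = (\<Sum>k<n. \<rho> u $$ (i,k) * s $ k)"
        using act[OF i sc] i by (simp add: \<rho>_def)
      also have "\<dots> = (\<Sum>k<n. \<rho> u $$ (i,k) * (\<Sum>b\<in>K. \<mu> (inv b) * (\<rho> b *\<^sub>v w1) $ k))"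
        using s(2) by simp
      also have "\<dots> = (\<Sum>b\<in>K. \<mu> (inv b) * (\<Sum>k<n. \<rho> u $$ (i,k) * (\<rho> b *\<^sub>v w1) $ k))"
        unfolding sum_distrib_left by (subst sum.swap) (simp add: mult.left_commute)
      also have "\<dots> = (\<Sum>b\<in>K. \<mu> (inv b) * (\<rho> (u \<otimes> b) *\<^sub>v w1) $ i)"
      proof (rule sum.cong[OF refl])
        fix b assume b: "b \<in> K"
        have "\<rho> (u \<otimes> b) *\<^sub>v w1 = \<rho> u *\<^sub>v (\<rho> b *\<^sub>v w1)"
          using mult[of u b] carr u b assoc_mult_mat_vec[OF dim dim w1c] by simp
        then show "\<mu> (inv b) * (\<Sum>k<n. \<rho> u $$ (i,k) * (\<rho> b *\<^sub>v w1) $ k) = \<mu> (inv b) * (\<rho> (u \<otimes> b) *\<^sub>v w1) $ i"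
          using act[OF i, of "\<rho> b *\<^sub>v w1" u] i mult_mat_vec_carrier[OF dim w1c] by (simp add: \<rho>_def)
      qed
      also have "\<dots> = (\<Sum>b\<in>K. \<mu> u * (\<mu> (inv (u \<otimes> b)) * (\<rho> (u \<otimes> b) *\<^sub>v w1) $ i))"
        using u char_nonzero[OF u] by (intro sum.cong) (auto simp: char_inv char_mult)
      also have "\<dots> = \<mu> u * (\<Sum>b\<in>K. \<mu> (inv b) * (\<rho> b *\<^sub>v w1) $ i)"
        using sum.reindex_bij_betw[OF bij_subgroup_mult_left[OF sub u],
            of "\<lambda>b. \<mu> (inv b) * (\<rho> b *\<^sub>v w1) $ i"] by (simp add: sum_distrib_left[symmetric])
      finally show ?thesis using s(2) i by simp
    qed
    have s0: "s $ 0 \<noteq> 0"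
    proof -
      have "\<mu> (inv b) * (\<rho> b *\<^sub>v w1) $ 0 = w1 $ 0" if b: "b \<in> K" for b
      proof -
        have "(\<rho> b *\<^sub>v w1) $ 0 = \<mu> b * w1 $ 0"
          using act[OF n w1c, of b] row[OF carr[OF b] n, of "\<lambda>k. w1 $ k"] carr[OF b] b by (simp add: t0)
        then show ?thesis using b char_inv_left by simp
      qed
      then have "s $ 0 = of_nat (card K) * w1 $ 0" using s(2) n by simp
      then show ?thesis using w10 card_subgroup_pos[OF sub] by simp
    qed
    \<comment> \<open>With u from Mackey's condition, \<open>\<rho> u\<close> multiplies coordinate
      i by the value of \<mu> at the conjugate of u by \<open>t i\<close>, because the matrix is
      monomial, and by \<open>\<mu> u\<close>, because s is an eigenvector. The two values
      differ.\<close>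
    have s_other: "s $ i = 0" if i: "i < n" "i \<noteq> 0" for i
    proof -
      have ti: "t i \<in> carrier G" using tc i by simp
      have "t i \<notin> K" using diag[of i 0] i n t0 ti by simp
      then obtain u where u: "u \<in> K" "t i \<otimes> u \<otimes> inv (t i) \<in> K" "\<mu> (t i \<otimes> u \<otimes> inv (t i)) \<noteq> \<mu> u"
        using mackey ti unfolding mackey_irreducible_def by blast
      have "(\<rho> u *\<^sub>v s) $ i = \<mu> (t i \<otimes> u \<otimes> inv (t i)) * s $ i"
        using act[OF i(1) sc] row[of "t i \<otimes> u" i "\<lambda>k. s $ k"] u ti carr i by simp
      then show ?thesis using eigen[OF u(1) i(1)] u(3) by simp
    qed
    define e0 where "e0 = inverse (s $ 0) \<cdot>\<^sub>v s"
    have e0: "e0 \<in> W" "e0 \<in> carrier_vec n" using Wsmult s sc by (auto simp: e0_def)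
    have e0i: "e0 $ i = (if i = 0 then 1 else 0)" if "i < n" for i
      using that s0 s_other sc by (simp add: e0_def)
    have e: "(\<rho> (inv (t j)) *\<^sub>v e0) $ i = (if i = j then 1 else 0)" if ij: "i < n" "j < n" for i j
    proof -
      have "(\<rho> (inv (t j)) *\<^sub>v e0) $ i = (\<Sum>k<n. ?z (t i \<otimes> inv (t j) \<otimes> inv (t k)) * (if k = 0 then 1 else 0))"
        using act[OF ij(1) e0(2), of "inv (t j)"] by (simp add: e0i)
      also have "\<dots> = (\<Sum>k<n. if k = 0 then ?z (t i \<otimes> inv (t j)) else 0)"
        using ij tc by (intro sum.cong) (auto simp: t0)
      finally have "(\<rho> (inv (t j)) *\<^sub>v e0) $ i = ?z (t i \<otimes> inv (t j))" using n by simp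
      then show ?thesis using n ij diag char_one tc by (auto simp: zero_ext_def)
    qed
    have "v \<in> W" if v: "v \<in> carrier_vec n" for v
    proof -
      obtain s' where s': "s' \<in> W" "\<forall>i<n. s' $ i = (\<Sum>j\<in>{..<n}. v $ j * (\<rho> (inv (t j)) *\<^sub>v e0) $ i)"
        using invariant_subspace_combination[OF W, of "{..<n}" "\<lambda>j. \<rho> (inv (t j)) *\<^sub>v e0" "\<lambda>j. v $ j"]
          Wact e0 tc by auto
      have "s' = v"
      proof (rule eq_vecI)
        show "dim_vec s' = dim_vec v" using s'(1) Wc v by (auto simp: subset_iff)
        show "s' $ i = v $ i" if "i < dim_vec v" for i
          using that v s'(2) by (simp add: e if_distrib[of "\<lambda>x. _ * x"] cong: if_cong)
      qed
      then show ?thesis using s' by simp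
    qed
    then show ?thesis using Wc by blast
  qed simp
  have "induced_char G K \<mu> g = mat_trace (\<rho> g)" if g: "g \<in> carrier G" for g
  proof -
    let ?f = "\<lambda>x. ?z (x \<otimes> g \<otimes> inv x)"
    \<comment> \<open>Writing x as \<open>b \<otimes> t i\<close> turns the sum over G into
      \<open>card K\<close> copies of the trace, as \<open>zero_ext K \<mu>\<close> is invariant
      under conjugation by K.\<close>
    have "bij_betw (\<lambda>(b,i). b \<otimes> t i) (K \<times> {..<n}) (carrier G)"
    proof (rule bij_betwI')
      fix p q assume pq: "p \<in> K \<times> {..<n}" "q \<in> K \<times> {..<n}"
      obtain b i where p: "p = (b,i)" "b \<in> K" "i < n" using pq(1) by auto
      obtain c j where q: "q = (c,j)" "c \<in> K" "j < n" using pq(2) by auto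
      have cc: "b \<in> carrier G" "c \<in> carrier G" "t i \<in> carrier G" "t j \<in> carrier G" using p q carr tc by auto
      have "b = c \<and> i = j" if eq: "b \<otimes> t i = c \<otimes> t j"
      proof -
        have "b \<otimes> t i \<otimes> inv (t i) \<in> K" "b \<otimes> t i \<otimes> inv (t j) \<in> K"
          using cc p q by (simp add: m_assoc, simp add: eq m_assoc)
        then have "i = j" using ex1[of "b \<otimes> t i"] cc p q by blast
        then show ?thesis using eq cc by simp
      qed
      then show "((\<lambda>(b,i). b \<otimes> t i) p = (\<lambda>(b,i). b \<otimes> t i) q) = (p = q)" using p q by auto
    next
      fix p assume "p \<in> K \<times> {..<n}"
      then show "(\<lambda>(b,i). b \<otimes> t i) p \<in> carrier G" using carr tc by auto
    next
      fix x assume x: "x \<in> carrier G"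
      then obtain i where i: "i < n" "x \<otimes> inv (t i) \<in> K" using ex1 by blast
      have "x = (x \<otimes> inv (t i)) \<otimes> t i" using x tc[OF i(1)] by (simp add: m_assoc)
      then show "\<exists>p\<in>K \<times> {..<n}. x = (\<lambda>(b,i). b \<otimes> t i) p" using i by force
    qed
    then have "(\<Sum>x\<in>carrier G. ?f x) = (\<Sum>p\<in>K \<times> {..<n}. ?f ((\<lambda>(b,i). b \<otimes> t i) p))"
      by (rule sum.reindex_bij_betw[symmetric])
    also have "\<dots> = (\<Sum>b\<in>K. \<Sum>i<n. ?f (b \<otimes> t i))"
      by (simp add: sum.cartesian_product case_prod_unfold)
    also have "\<dots> = (\<Sum>b\<in>K. \<Sum>i<n. ?f (t i))"
    proof (intro sum.cong refl)
      fix b i assume "b \<in> K" "i \<in> {..<n}"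
      then have c: "b \<in> K" "b \<in> carrier G" "t i \<in> carrier G" using carr tc by auto
      have "b \<otimes> t i \<otimes> g \<otimes> inv (b \<otimes> t i) = b \<otimes> (t i \<otimes> g \<otimes> inv (t i)) \<otimes> inv b"
        using c g by (simp add: inv_mult_group m_assoc)
      then show "?f (b \<otimes> t i) = ?f (t i)" using zero_ext_conj c g by simp
    qed
    also have "\<dots> = of_nat (card K) * mat_trace (\<rho> g)"
      by (simp add: mat_trace_def \<rho>_def)
    finally show ?thesis using card_subgroup_pos[OF sub] by (simp add: induced_char_zero_ext)
  qed
  moreover have "irreducible_rep G n \<rho>" unfolding irreducible_rep_def using rep irred by blast
  ultimately show ?thesis unfolding irr_char_def by blast
qed

end

section \<open>Passage to a subgroup and induction in stages\<close>

lemma (in finite_group) linear_characterI: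
  assumes "subgroup K G" "\<mu> \<one> = 1" "\<And>x y. x \<in> K \<Longrightarrow> y \<in> K \<Longrightarrow> \<mu> (x \<otimes> y) = \<mu> x * \<mu> y"
  shows "linear_character G K \<mu>"
  using assms by (intro linear_character.intro linear_character_axioms.intro finite_group_axioms)

lemma (in linear_character) linear_character_restrict:
  assumes H: "subgroup H G" and "K \<subseteq> H"
  shows "linear_character (G\<lparr>carrier := H\<rparr>) K \<mu>"
proof -
  interpret H: group "G\<lparr>carrier := H\<rparr>" by (rule subgroup_imp_group[OF H])
  show ?thesis
    using finite_subgroup[OF H] subgroup_incl[OF sub H assms(2)] char_one char_mult
    by (intro linear_character.intro finite_group.intro H.group_axioms
        finite_group_axioms.intro linear_character_axioms.intro) auto
qed

lemma (in finite_group) mackey_irreducible_restrict: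
  assumes "subgroup H G" "mackey_irreducible G H K \<mu>"
  shows "mackey_irreducible (G\<lparr>carrier := H\<rparr>) (carrier (G\<lparr>carrier := H\<rparr>)) K \<mu>"
  using assms unfolding mackey_irreducible_def by simp

text \<open>The inner sum over H is absorbed by the outer sum over G through the substitution of
  \<open>h \<otimes> x\<close> for x, leaving a factor \<open>card H\<close>. Outside H the inner
  sum vanishes, since no H-conjugate of such an element lies in K.\<close>

lemma (in linear_character) induced_char_trans:
  assumes H: "subgroup H G" and KH: "K \<subseteq> H" and g: "g \<in> carrier G"
  shows "induced_char G H (induced_char (G\<lparr>carrier := H\<rparr>) K \<mu>) g = induced_char G K \<mu> g"
proof -
  let ?z = "zero_ext K \<mu>"
  have Hc: "h \<in> carrier G" if "h \<in> H" for h using H that subgroup.subset by blast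
  have "zero_ext H (induced_char (G\<lparr>carrier := H\<rparr>) K \<mu>) x = (\<Sum>h\<in>H. ?z (h \<otimes> x \<otimes> inv h)) / of_nat (card K)"
    if x: "x \<in> carrier G" for x
  proof (cases "x \<in> H")
    case True
    then show ?thesis using H by (simp add: zero_ext_def induced_char_zero_ext)
  next
    case False
    have "h \<otimes> x \<otimes> inv h \<notin> K" if h: "h \<in> H" for h
    proof
      assume "h \<otimes> x \<otimes> inv h \<in> K"
      then have "inv h \<otimes> (h \<otimes> x \<otimes> inv h) \<otimes> h \<in> H"
        using KH H h by (meson subgroup.m_closed subgroup.m_inv_closed subsetD)
      moreover have "inv h \<otimes> (h \<otimes> x \<otimes> inv h) \<otimes> h = x"
        using x Hc[OF h] by (simp add: m_assoc) (simp add: m_assoc[symmetric])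
      ultimately show False using False by simp
    qed
    then show ?thesis using False by (simp add: zero_ext_def)
  qed
  then have "induced_char G H (induced_char (G\<lparr>carrier := H\<rparr>) K \<mu>) g
      = (\<Sum>x\<in>carrier G. \<Sum>h\<in>H. ?z (h \<otimes> (x \<otimes> g \<otimes> inv x) \<otimes> inv h)) / of_nat (card K) / of_nat (card H)"
    using g by (simp add: induced_char_zero_ext sum_divide_distrib)
  also have "(\<Sum>x\<in>carrier G. \<Sum>h\<in>H. ?z (h \<otimes> (x \<otimes> g \<otimes> inv x) \<otimes> inv h))
      = (\<Sum>h\<in>H. \<Sum>x\<in>carrier G. ?z (h \<otimes> (x \<otimes> g \<otimes> inv x) \<otimes> inv h))" by (rule sum.swap)
  also have "\<dots> = (\<Sum>h\<in>H. \<Sum>x\<in>carrier G. ?z (x \<otimes> g \<otimes> inv x))"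
  proof (rule sum.cong[OF refl])
    fix h assume h: "h \<in> H"
    have bij: "bij_betw (\<lambda>x. h \<otimes> x) (carrier G) (carrier G)"
      using bij_subgroup_mult_left[OF subgroup_self Hc[OF h]] .
    have "(\<Sum>x\<in>carrier G. ?z (h \<otimes> (x \<otimes> g \<otimes> inv x) \<otimes> inv h))
        = (\<Sum>x\<in>carrier G. ?z ((h \<otimes> x) \<otimes> g \<otimes> inv (h \<otimes> x)))"
      using g Hc[OF h] by (intro sum.cong) (auto simp: inv_mult_group m_assoc)
    then show "(\<Sum>x\<in>carrier G. ?z (h \<otimes> (x \<otimes> g \<otimes> inv x) \<otimes> inv h)) = (\<Sum>x\<in>carrier G. ?z (x \<otimes> g \<otimes> inv x))"
      using sum.reindex_bij_betw[OF bij, of "\<lambda>x. ?z (x \<otimes> g \<otimes> inv x)"] by simp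
  qed
  finally show ?thesis using card_subgroup_pos[OF H]
    by (simp add: induced_char_zero_ext[of G K \<mu> g])
qed

section \<open>Multiplicities as counts of double cosets\<close>

locale two_linear_characters = K: linear_character G K \<mu> + B: linear_character G B \<nu>
  for G (structure) and K \<mu> B \<nu>
begin

text \<open>The contribution of y to the inner product of the induced characters: up to
  normalisation, the inner product of \<mu> with the conjugate of \<nu> by y on their common
  domain.\<close>

definition hecke_sum :: "'a \<Rightarrow> complex" where
  "hecke_sum y = (\<Sum>g\<in>carrier G. zero_ext K \<mu> g * cnj (zero_ext B \<nu> (y \<otimes> g \<otimes> inv y)))"

definition double_coset :: "'a \<Rightarrow> 'a set" where
  "double_coset y = (\<lambda>(b,k). b \<otimes> y \<otimes> k) ` (B \<times> K)"

abbreviation isotropy :: "'a \<Rightarrow> 'a set" where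
  "isotropy y \<equiv> {g \<in> K. y \<otimes> g \<otimes> inv y \<in> B}"

definition compatible :: "'a \<Rightarrow> bool" where
  "compatible y \<longleftrightarrow> (\<forall>g\<in>K. y \<otimes> g \<otimes> inv y \<in> B \<longrightarrow> \<nu> (y \<otimes> g \<otimes> inv y) = \<mu> g)"

text \<open>In the triple sum over g, x, y, replacing y by \<open>y \<otimes> x\<close> and then
  conjugating g by x removes x from the summand. The free sum over x cancels the order of G.\<close>

lemma char_inner_induced_chars:
  "char_inner G (induced_char G K \<mu>) (induced_char G B \<nu>)
    = (\<Sum>y\<in>carrier G. hecke_sum y) / of_nat (card K * card B)"
proof -
  let ?k = "zero_ext K \<mu>" and ?b = "zero_ext B \<nu>"
  have "(\<Sum>g\<in>carrier G. (\<Sum>x\<in>carrier G. ?k (x \<otimes> g \<otimes> inv x)) * cnj (\<Sum>y\<in>carrier G. ?b (y \<otimes> g \<otimes> inv y)))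
     = (\<Sum>g\<in>carrier G. \<Sum>x\<in>carrier G. \<Sum>y\<in>carrier G. ?k (x \<otimes> g \<otimes> inv x) * cnj (?b (y \<otimes> g \<otimes> inv y)))"
    by (simp add: sum_product)
  also have "\<dots> = (\<Sum>x\<in>carrier G. \<Sum>g\<in>carrier G. \<Sum>y\<in>carrier G. ?k (x \<otimes> g \<otimes> inv x) * cnj (?b (y \<otimes> g \<otimes> inv y)))"
    by (rule sum.swap)
  also have "\<dots> = (\<Sum>x\<in>carrier G. \<Sum>y\<in>carrier G. hecke_sum y)"
  proof (rule sum.cong[OF refl])
    fix x assume x: "x \<in> carrier G"
    have "(\<Sum>g\<in>carrier G. \<Sum>y\<in>carrier G. ?k (x \<otimes> g \<otimes> inv x) * cnj (?b (y \<otimes> g \<otimes> inv y)))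
       = (\<Sum>g\<in>carrier G. \<Sum>y\<in>carrier G. ?k (x \<otimes> g \<otimes> inv x) * cnj (?b ((y \<otimes> x) \<otimes> g \<otimes> inv (y \<otimes> x))))"
      by (intro sum.cong refl sum.reindex_bij_betw[OF K.bij_mult_right[OF x], symmetric])
    also have "\<dots> = (\<Sum>g\<in>carrier G. \<Sum>y\<in>carrier G. ?k (x \<otimes> g \<otimes> inv x) * cnj (?b (y \<otimes> (x \<otimes> g \<otimes> inv x) \<otimes> inv y)))"
      using x by (intro sum.cong) (auto simp: K.inv_mult_group K.m_assoc)
    also have "\<dots> = (\<Sum>g\<in>carrier G. \<Sum>y\<in>carrier G. ?k g * cnj (?b (y \<otimes> g \<otimes> inv y)))"
      using sum.reindex_bij_betw[OF K.bij_conj[OF x], of "\<lambda>g. \<Sum>y\<in>carrier G. ?k g * cnj (?b (y \<otimes> g \<otimes> inv y))"] .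
    also have "\<dots> = (\<Sum>y\<in>carrier G. hecke_sum y)" unfolding hecke_sum_def by (rule sum.swap)
    finally show "(\<Sum>g\<in>carrier G. \<Sum>y\<in>carrier G. ?k (x \<otimes> g \<otimes> inv x) * cnj (?b (y \<otimes> g \<otimes> inv y))) = (\<Sum>y\<in>carrier G. hecke_sum y)" .
  qed
  finally show ?thesis
    using K.card_subgroup_pos[OF K.subgroup_self]
    by (simp add: char_inner_def induced_char_zero_ext sum_divide_distrib[symmetric])
qed

text \<open>The summand restricts to a linear character \<alpha> of the isotropy group, whose sum is
  the group order or 0; it is trivial exactly when y is compatible.\<close>

lemma hecke_sum_eq:
  assumes y: "y \<in> carrier G"
  shows "hecke_sum y = (if compatible y then of_nat (card (isotropy y)) else 0)"
proof -
  define \<alpha> where "\<alpha> g = \<mu> g * cnj (\<nu> (y \<otimes> g \<otimes> inv y))" for g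
  have conj_mult: "y \<otimes> (g \<otimes> h) \<otimes> inv y = (y \<otimes> g \<otimes> inv y) \<otimes> (y \<otimes> h \<otimes> inv y)"
    if "g \<in> K" "h \<in> K" for g h
  proof -
    have "inv y \<otimes> (y \<otimes> (h \<otimes> inv y)) = h \<otimes> inv y"
      using y K.carr[OF that(2)] by (simp add: K.m_assoc[symmetric])
    then show ?thesis using y that K.carr by (simp add: K.m_assoc)
  qed
  have conj_inv: "y \<otimes> inv g \<otimes> inv y = inv (y \<otimes> g \<otimes> inv y)" if "g \<in> K" for g
    using y that K.carr by (simp add: K.inv_mult_group K.m_assoc)
  have "subgroup (isotropy y) G"
    using y K.carr by (intro K.subgroupI) (auto simp: conj_mult conj_inv intro!: exI[of _ \<one>])
  moreover have "\<alpha> \<one> = 1" using y by (simp add: \<alpha>_def K.char_one B.char_one)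
  moreover have "\<alpha> (g \<otimes> h) = \<alpha> g * \<alpha> h" if "g \<in> isotropy y" "h \<in> isotropy y" for g h
    using that by (auto simp: \<alpha>_def conj_mult K.char_mult B.char_mult)
  ultimately interpret A: linear_character G "isotropy y" \<alpha>
    by (rule K.linear_characterI)
  have "hecke_sum y = (\<Sum>g\<in>isotropy y. \<alpha> g)"
    unfolding hecke_sum_def using K.carr
    by (intro sum.mono_neutral_cong_right) (auto simp: K.finite_carrier zero_ext_def \<alpha>_def)
  moreover have "(\<forall>g\<in>isotropy y. \<alpha> g = 1) \<longleftrightarrow> compatible y"
    unfolding compatible_def \<alpha>_def using K.char_nonzero B.char_nonzero
    by (auto simp: B.cnj_char field_simps)
  ultimately show ?thesis using A.sum_char by simp
qed

lemma hecke_sum_double_coset: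
  assumes y: "y \<in> carrier G" and "b \<in> B" "k \<in> K"
  shows "hecke_sum (b \<otimes> y \<otimes> k) = hecke_sum y"
proof -
  have c: "b \<in> carrier G" "k \<in> carrier G" using assms K.carr B.carr by auto
  have "zero_ext K \<mu> g * cnj (zero_ext B \<nu> (b \<otimes> y \<otimes> k \<otimes> g \<otimes> inv (b \<otimes> y \<otimes> k)))
     = zero_ext K \<mu> (k \<otimes> g \<otimes> inv k) * cnj (zero_ext B \<nu> (y \<otimes> (k \<otimes> g \<otimes> inv k) \<otimes> inv y))"
    if g: "g \<in> carrier G" for g
  proof -
    have "b \<otimes> y \<otimes> k \<otimes> g \<otimes> inv (b \<otimes> y \<otimes> k) = b \<otimes> (y \<otimes> (k \<otimes> g \<otimes> inv k) \<otimes> inv y) \<otimes> inv b"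
      using c y g by (simp add: K.inv_mult_group K.m_assoc)
    then show ?thesis using c y g assms by (simp add: K.zero_ext_conj B.zero_ext_conj)
  qed
  then show ?thesis unfolding hecke_sum_def
    using sum.reindex_bij_betw[OF K.bij_conj[OF c(2)],
        of "\<lambda>g. zero_ext K \<mu> g * cnj (zero_ext B \<nu> (y \<otimes> g \<otimes> inv y))"] by simp
qed

lemma double_coset_subset: "y \<in> carrier G \<Longrightarrow> double_coset y \<subseteq> carrier G"
  using K.carr B.carr by (auto simp: double_coset_def)

text \<open>A lower bound suffices for the multiplicity: with one factorisation of x fixed, sending
  (b, k) to \<open>k \<otimes> inv k0\<close> embeds the fibre over x into the isotropy
  group.\<close>

lemma card_double_coset:
  assumes y: "y \<in> carrier G"
  shows "card B * card K \<le> card (double_coset y) * card (isotropy y)"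
proof -
  let ?f = "\<lambda>(b,k). b \<otimes> y \<otimes> k"
  have fin: "finite (B \<times> K)" using K.finite_subgroup K.sub B.sub by blast
  have fibre: "card {p \<in> B \<times> K. ?f p = x} \<le> card (isotropy y)" if x: "x \<in> double_coset y" for x
  proof -
    obtain b0 k0 where x0: "b0 \<in> B" "k0 \<in> K" "x = b0 \<otimes> y \<otimes> k0" using x by (auto simp: double_coset_def)
    have c0: "b0 \<in> carrier G" "k0 \<in> carrier G" using x0 K.carr B.carr by auto
    have "(\<lambda>(b,k). k \<otimes> inv k0) ` {p \<in> B \<times> K. ?f p = x} \<subseteq> isotropy y"
    proof (rule image_subsetI)
      fix p assume "p \<in> {p \<in> B \<times> K. ?f p = x}"
      then obtain b k where bk: "p = (b,k)" "b \<in> B" "k \<in> K" "b \<otimes> y \<otimes> k = x" by auto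
      have c: "b \<in> carrier G" "k \<in> carrier G" using bk K.carr B.carr by auto
      have "y \<otimes> k = inv b \<otimes> (b \<otimes> y \<otimes> k)" using c y by (simp add: K.m_assoc[symmetric])
      also have "\<dots> = inv b \<otimes> (b0 \<otimes> y \<otimes> k0)" using bk x0 by simp
      finally have "y \<otimes> (k \<otimes> inv k0) \<otimes> inv y = inv b \<otimes> (b0 \<otimes> y \<otimes> k0) \<otimes> inv k0 \<otimes> inv y"
        using c c0 y by (simp add: K.m_assoc[symmetric])
      also have "\<dots> = inv b \<otimes> b0" using c c0 y by (simp add: K.m_assoc)
      finally show "(\<lambda>(b,k). k \<otimes> inv k0) p \<in> isotropy y" using bk x0 by simp
    qed
    moreover have "inj_on (\<lambda>(b,k). k \<otimes> inv k0) {p \<in> B \<times> K. ?f p = x}"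
    proof (rule inj_onI)
      fix p q assume pq: "p \<in> {p \<in> B \<times> K. ?f p = x}" "q \<in> {p \<in> B \<times> K. ?f p = x}"
        and e: "(\<lambda>(b,k). k \<otimes> inv k0) p = (\<lambda>(b,k). k \<otimes> inv k0) q"
      obtain b k where p: "p = (b,k)" "b \<in> B" "k \<in> K" "b \<otimes> y \<otimes> k = x" using pq(1) by auto
      obtain b' k' where q: "q = (b',k')" "b' \<in> B" "k' \<in> K" "b' \<otimes> y \<otimes> k' = x" using pq(2) by auto
      have c: "b \<in> carrier G" "k \<in> carrier G" "b' \<in> carrier G" "k' \<in> carrier G" using p q K.carr B.carr by auto
      have "k = k'" using e p(1) q(1) c c0 by simp
      moreover have "b \<otimes> y \<otimes> k = b' \<otimes> y \<otimes> k'" using p q by simp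
      ultimately have "b = b'" using c y by simp
      then show "p = q" using \<open>k = k'\<close> p q by simp
    qed
    ultimately show ?thesis using K.finite_subgroup[OF K.sub] by (intro card_inj_on_le[of "\<lambda>(b,k). k \<otimes> inv k0"]) auto
  qed
  have "card B * card K = card (B \<times> K)" by (simp add: card_cartesian_product)
  also have "\<dots> = (\<Sum>p\<in>B \<times> K. 1)" by simp
  also have "\<dots> = (\<Sum>x\<in>double_coset y. card {p \<in> B \<times> K. ?f p = x})"
    unfolding double_coset_def using fin sum.image_gen[of "B \<times> K" "\<lambda>_. 1::nat" ?f] by simp
  also have "\<dots> \<le> card (double_coset y) * card (isotropy y)"
    using sum_bounded_above[OF fibre, of "double_coset y"] by simp
  finally show ?thesis .
qed

lemma Re_hecke_sum_nonneg: "y \<in> carrier G \<Longrightarrow> Re (hecke_sum y) \<ge> 0"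
  by (simp add: hecke_sum_eq)

lemma Re_sum_hecke_double_coset:
  assumes y: "y \<in> carrier G" and "compatible y"
  shows "(\<Sum>x\<in>double_coset y. Re (hecke_sum x)) \<ge> of_nat (card K * card B)"
proof -
  have "(\<Sum>x\<in>double_coset y. Re (hecke_sum x)) = (\<Sum>x\<in>double_coset y. real (card (isotropy y)))"
    using y assms(2) by (intro sum.cong) (auto simp: double_coset_def hecke_sum_double_coset hecke_sum_eq)
  then show ?thesis using card_double_coset[OF y]
    by (simp add: mult.commute flip: of_nat_mult)
qed

text \<open>All Hecke sums are nonnegative, and each of two disjoint compatible double cosets
  contributes at least 1 after division by \<open>card K * card B\<close>.\<close>

lemma char_inner_ge_2:
  assumes y: "y1 \<in> carrier G" "y2 \<in> carrier G" "compatible y1" "compatible y2"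
    and disj: "y2 \<notin> double_coset y1"
  shows "Re (char_inner G (induced_char G K \<mu>) (induced_char G B \<nu>)) \<ge> 2"
proof -
  have "double_coset y1 \<inter> double_coset y2 = {}"
  proof (rule ccontr)
    assume "\<not> ?thesis"
    then obtain b k b' k' where e: "b \<in> B" "b' \<in> B" "k \<in> K" "k' \<in> K" "b \<otimes> y1 \<otimes> k = b' \<otimes> y2 \<otimes> k'"
      by (auto simp: double_coset_def)
    have c: "b \<in> carrier G" "k \<in> carrier G" "b' \<in> carrier G" "k' \<in> carrier G" using e K.carr B.carr by auto
    have "y2 = inv b' \<otimes> (b' \<otimes> y2 \<otimes> k') \<otimes> inv k'" using c y by (simp add: K.m_assoc) (simp add: K.m_assoc[symmetric])
    also have "\<dots> = (inv b' \<otimes> b) \<otimes> y1 \<otimes> (k \<otimes> inv k')" using c y unfolding e(5)[symmetric] by (simp add: K.m_assoc)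
    finally have "y2 \<in> double_coset y1" unfolding double_coset_def using e
      by (intro image_eqI[of _ _ "(inv b' \<otimes> b, k \<otimes> inv k')"]) auto
    then show False using disj by simp
  qed
  moreover have fin: "finite (double_coset y)" if "y \<in> carrier G" for y
    using double_coset_subset[OF that] K.finite_carrier finite_subset by blast
  ultimately have "2 * real (card K * card B) \<le> (\<Sum>x\<in>double_coset y1 \<union> double_coset y2. Re (hecke_sum x))"
    using Re_sum_hecke_double_coset[of y1] Re_sum_hecke_double_coset[of y2] y by (simp add: sum.union_disjoint)
  also have "\<dots> \<le> (\<Sum>x\<in>carrier G. Re (hecke_sum x))"
    using double_coset_subset y Re_hecke_sum_nonneg by (intro sum_mono2 K.finite_carrier) auto
  finally have "2 * real (card K * card B) \<le> Re (\<Sum>x\<in>carrier G. hecke_sum x)" by simp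
  moreover have "real (card K * card B) > 0"
    using K.card_subgroup_pos K.sub B.sub by simp
  ultimately show ?thesis unfolding char_inner_induced_chars
    by (simp add: Re_divide_of_nat pos_le_divide_eq del: of_nat_mult)
qed

theorem not_strong_gelfand_pair:
  assumes H: "subgroup H G" "K \<subseteq> H"
    and "mackey_irreducible G H K \<mu>" "mackey_irreducible G (carrier G) B \<nu>"
    and y: "y1 \<in> carrier G" "y2 \<in> carrier G" "compatible y1" "compatible y2" "y2 \<notin> double_coset y1"
  shows "\<not> strong_gelfand_pair G H"
proof
  assume sgp: "strong_gelfand_pair G H"
  let ?\<psi> = "induced_char (G\<lparr>carrier := H\<rparr>) K \<mu>"
  have "irr_char (G\<lparr>carrier := H\<rparr>) ?\<psi>"
    using linear_character.irr_char_induced_char[OF K.linear_character_restrict[OF H]]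
      K.mackey_irreducible_restrict[OF H(1)] assms(3) by blast
  moreover have "irr_char G (induced_char G B \<nu>)" by (rule B.irr_char_induced_char[OF assms(4)])
  ultimately have "Re (char_inner G (induced_char G H ?\<psi>) (induced_char G B \<nu>)) \<le> 1"
    using sgp unfolding strong_gelfand_pair_def by blast
  moreover have "char_inner G (induced_char G H ?\<psi>) (induced_char G B \<nu>)
     = char_inner G (induced_char G K \<mu>) (induced_char G B \<nu>)"
    unfolding char_inner_def using K.induced_char_trans[OF H] by simp
  ultimately show False using char_inner_ge_2[OF y] by simp
qed

end

section \<open>Characters of finite fields\<close>

lemma cis_pow_neq_one:
  assumes "0 < k" "k < N" shows "cis (2 * pi / real N) ^ k \<noteq> 1"
proof
  assume "cis (2 * pi / real N) ^ k = 1"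
  then have "cis (real k * (2 * pi / real N)) = 1" by (simp add: Complex.DeMoivre)
  then have "cos (real k * (2 * pi / real N)) = 1" by (metis cis.simps(1) one_complex.simps(1))
  then obtain m :: int where "real k * (2 * pi / real N) = of_int m * 2 * pi"
    using cos_one_2pi_int by blast
  then have "real k = of_int m * real N" using assms by (simp add: field_simps)
  then have "int k = m * int N"
    by (metis of_int_eq_iff of_int_mult of_int_of_nat_eq)
  then show False using assms
    by (metis int_dvd_int_iff dvd_triv_right nat_dvd_not_less)
qed

lemma power_mod_eq:
  fixes x :: "'a::monoid_mult" assumes "x ^ N = 1" shows "x ^ (i mod N) = x ^ i"
proof -
  have "x ^ i = x ^ (N * (i div N) + i mod N)" by simp
  also have "\<dots> = x ^ (i mod N)" unfolding power_add power_mult assms by simp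
  finally show ?thesis by simp
qed

definition mult_character :: "('f::field \<Rightarrow> complex) \<Rightarrow> bool" where
  "mult_character \<theta> \<longleftrightarrow> \<theta> 1 = 1 \<and> (\<forall>x y. x \<noteq> 0 \<longrightarrow> y \<noteq> 0 \<longrightarrow> \<theta> (x * y) = \<theta> x * \<theta> y)"

text \<open>A generator of the cyclic multiplicative group is sent to a primitive root of unity.
  Taking t to be that generator gives a single element that witnesses the nontriviality of all the
  required powers of \<theta> at once.\<close>

lemma finite_field_character:
  assumes "card (UNIV :: 'a::{finite,field} set) > 2"
  obtains \<theta> :: "'a::{finite,field} \<Rightarrow> complex" and t where "t \<noteq> 0" "mult_character \<theta>"
    "\<forall>k>0. k < card (UNIV :: 'a set) - 1 \<longrightarrow> \<theta> t ^ k \<noteq> 1"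
proof -
  define R :: "'a ring" where "R = class_ring"
  interpret R: field R unfolding R_def by (rule class_field)
  interpret M: group "mult_of R" by (rule R.field_mult_group)
  have carr: "carrier (mult_of R) = UNIV - {0}" by (simp add: R_def)
  have pow: "x [^]\<^bsub>mult_of R\<^esub> n = x ^ n" for x :: 'a and n :: nat
    by (induction n) (simp_all add: R_def mult.commute)
  define N where "N = card (UNIV :: 'a set) - 1"
  have N: "card (UNIV - {0::'a}) = N" "N > 1" using assms by (simp_all add: N_def card_Diff_singleton)
  obtain g :: 'a where g0: "g \<noteq> 0" and gen: "UNIV - {0} = {g ^ i | i::nat. True}"
    using R.finite_field_mult_group_has_gen carr by (auto simp: R_def class_ring_simps)
  have "Coset.order (mult_of R) = N" unfolding Coset.order_def carr by (rule N(1))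
  then have gN: "g ^ N = 1"
    using M.pow_order_eq_1[of g] g0 unfolding carr pow by (simp add: R_def)
  have gmod: "g ^ (i mod N) = g ^ i" for i
    by (rule power_mod_eq[OF gN])
  have "(\<lambda>i. g ^ i) ` {..<N} = UNIV - {0}"
  proof -
    have "g ^ i \<in> (\<lambda>i. g ^ i) ` {..<N}" for i
      using gmod[of i] N(2) by (intro image_eqI[of _ _ "i mod N"]) auto
    then show ?thesis unfolding gen by blast
  qed
  then have inj: "inj_on (\<lambda>i. g ^ i) {..<N}"
    using N(1) by (intro eq_card_imp_inj_on) auto
  have cong: "i mod N = j mod N" if "g ^ i = g ^ j" for i j
    using inj_onD[OF inj, of "i mod N" "j mod N"] that gmod N(2) by simp
  define z where "z = cis (2 * pi / real N)"
  have zN: "z ^ N = 1" using N(2) by (simp add: z_def Complex.DeMoivre)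
  have zmod: "z ^ (i mod N) = z ^ i" for i
    by (rule power_mod_eq[OF zN])
  \<comment> \<open>A discrete logarithm. Its value at 0 is arbitrary, which is harmless because
    \<open>mult_character\<close> constrains nonzero arguments only.\<close>
  define lg where "lg x = (SOME i. g ^ i = x)" for x
  have lg: "g ^ lg x = x" if "x \<noteq> 0" for x
  proof -
    have "x \<in> {g ^ i | i::nat. True}" using that gen by blast
    then show ?thesis unfolding lg_def by (metis (mono_tags, lifting) mem_Collect_eq someI_ex)
  qed
  have z_lg: "z ^ lg (g ^ i) = z ^ i" for i
    using cong[OF lg[of "g ^ i"]] g0 zmod by (metis power_not_zero)
  show thesis
  proof (rule that[of g "\<lambda>x. z ^ lg x"])
    have "z ^ lg (x * y) = z ^ lg x * z ^ lg y" if "x \<noteq> 0" "y \<noteq> 0" for x y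
      using z_lg[of "lg x + lg y"] that by (simp add: power_add lg)
    then show "mult_character (\<lambda>x. z ^ lg x)"
      using z_lg[of 0] by (simp add: mult_character_def)
    show "\<forall>k>0. k < card (UNIV :: 'a set) - 1 \<longrightarrow> (z ^ lg g) ^ k \<noteq> 1"
      using cis_pow_neq_one[of _ N] z_lg[of 1] unfolding N_def[symmetric] by (simp add: z_def)
  qed (rule g0)
qed

text \<open>An additive subgroup M maximal among those avoiding 1 has index 2, and \<phi> is the
  sign character with kernel M. Otherwise some x has neither x nor x + 1 in M, and adjoining x gives
  a larger subgroup that still avoids 1.\<close>

lemma char2_additive_character:
  assumes "(2::'a::{finite,field}) = 0"
  obtains \<phi> :: "'a::{finite,field} \<Rightarrow> complex" and c where
    "\<forall>x y. \<phi> (x + y) = \<phi> x * \<phi> y" "\<phi> 0 = 1" "\<forall>x. (\<phi> x)\<^sup>2 = 1" "\<phi> c \<noteq> 1"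
proof -
  have dbl: "x + x = 0" for x :: 'a
    using assms by (metis mult_2 mult_zero_left)
  define S where "S = {M :: 'a set. 0 \<in> M \<and> 1 \<notin> M \<and> (\<forall>x\<in>M. \<forall>y\<in>M. x + y \<in> M)}"
  have "{0} \<in> S" by (simp add: S_def)
  then obtain M where M: "M \<in> S" and max: "\<And>M'. M' \<in> S \<Longrightarrow> M \<subseteq> M' \<Longrightarrow> M' = M"
    using finite_has_maximal2[of S "{0}"] by auto
  have M0: "0 \<in> M" "1 \<notin> M" and Madd: "\<And>x y. x \<in> M \<Longrightarrow> y \<in> M \<Longrightarrow> x + y \<in> M"
    using M by (auto simp: S_def)
  have index2: "x + 1 \<in> M" if "x \<notin> M" for x
  proof (rule ccontr)
    assume n: "x + 1 \<notin> M"
    define M' where "M' = M \<union> (\<lambda>m. m + x) ` M"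
    have M'iff: "a \<in> M' \<longleftrightarrow> a \<in> M \<or> a + x \<in> M" for a
    proof -
      have r: "m + x + x = m" for m using dbl[of x] by (simp add: add.assoc)
      have "a + x \<in> M \<Longrightarrow> a \<in> (\<lambda>m. m + x) ` M"
        using r[of a] by (intro image_eqI[of _ _ "a + x"]) simp_all
      then show ?thesis using r unfolding M'_def by auto
    qed
    have "a + b \<in> M'" if "a \<in> M'" "b \<in> M'" for a b
    proof -
      have "(a + x) + (b + x) = a + b" "(a + x) + b = a + b + x" "a + (b + x) = a + b + x"
        using dbl[of x] by (simp_all add: algebra_simps)
      then show ?thesis using that Madd M'iff by metis
    qed
    moreover have "1 \<notin> M'"
    proof
      assume "1 \<in> M'"
      then show False using n M0 M'iff by (simp add: add.commute)
    qed
    ultimately have "M' \<in> S" using M0 by (auto simp: S_def M'_def)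
    then have "M' = M" using max by (auto simp: M'_def)
    then show False using that M0 by (auto simp: M'_def)
  qed
  show thesis
  proof (rule that[of "\<lambda>x. if x \<in> M then 1 else -1" 1])
    have "(if x + y \<in> M then 1 else -1 :: complex) = (if x \<in> M then 1 else -1) * (if y \<in> M then 1 else -1)" for x y
    proof -
      have "x + y \<notin> M" if "x \<in> M" "y \<notin> M"
        using Madd[OF \<open>x \<in> M\<close>, of "x + y"] that dbl[of x] by (auto simp: add.assoc[symmetric])
      moreover have "x + y \<notin> M" if "x \<notin> M" "y \<in> M"
        using Madd[OF _ \<open>y \<in> M\<close>, of "x + y"] that dbl[of y] by (auto simp: add.assoc)
      moreover have "x + y \<in> M" if "x \<notin> M" "y \<notin> M"
      proof -
        have "(x + 1) + (y + 1) = x + y" using dbl[of 1] by (simp add: algebra_simps)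
        then show ?thesis using Madd[OF index2[OF that(1)] index2[OF that(2)]] by simp
      qed
      ultimately show ?thesis using Madd by auto
    qed
    then show "\<forall>x y. (if x + y \<in> M then 1 else -1 :: complex) = (if x \<in> M then 1 else -1) * (if y \<in> M then 1 else -1)"
      by blast
  qed (use M0 in auto)
qed

section \<open>Symplectic spaces of dimension 4 in characteristic 2\<close>

text \<open>In a finite group an inverse is a power, so closure under products is enough; the groups
  below are defined by the shape of an action, for which inverses would need a computation.\<close>

lemma (in finite_group) subgroupI_finite:
  assumes "K \<subseteq> carrier G" "\<one> \<in> K" and mult: "\<And>x y. x \<in> K \<Longrightarrow> y \<in> K \<Longrightarrow> x \<otimes> y \<in> K"
  shows "subgroup K G"
proof (rule subgroupI)
  fix a assume a: "a \<in> K"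
  then have ac: "a \<in> carrier G" using assms(1) by blast
  have pow: "a [^] n \<in> K" for n :: nat
    by (induction n) (use a assms in auto)
  have pos: "Coset.order G > 0" using finite_carrier by (simp add: order_gt_0_iff_finite)
  have "a [^] (Coset.order G - 1) \<otimes> a = \<one>"
    using pos nat_pow_Suc[of a "Coset.order G - 1"] pow_order_eq_1[OF ac] by simp
  then have "inv a = a [^] (Coset.order G - 1)" using ac by (intro inv_equality) auto
  then show "inv a \<in> K" using pow by simp
qed (use assms in auto)

text \<open>A coordinate-free setting in which any symplectic basis can be used. By
  \<open>act_complete\<close>, group elements can be built by writing down isometries, and every
  membership question becomes one about the action.\<close>

locale char2_symplectic = finite_group G + vector_space scale
  for G :: "('g,'m) monoid_scheme" (structure)
    and scale :: "'f::{finite,field} \<Rightarrow> 'v::ab_group_add \<Rightarrow> 'v" (infixr "*s" 75) +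
  fixes act :: "'g \<Rightarrow> 'v \<Rightarrow> 'v" and B :: "'v \<Rightarrow> 'v \<Rightarrow> 'f"
  assumes char2: "(2::'f) = 0"
    and B_add: "\<And>x y z. B (x + y) z = B x z + B y z"
    and B_scale: "\<And>c x y. B (c *s x) y = c * B x y"
    and B_sym: "\<And>x y. B x y = B y x"
    and B_self [simp]: "\<And>x. B x x = 0"
    and B_nondegenerate: "\<And>x. (\<And>y. B x y = 0) \<Longrightarrow> x = 0"
    and act_add: "\<And>g x y. g \<in> carrier G \<Longrightarrow> act g (x + y) = act g x + act g y"
    and act_scale: "\<And>g c x. g \<in> carrier G \<Longrightarrow> act g (c *s x) = c *s act g x"
    and act_one [simp]: "\<And>x. act \<one> x = x"
    and act_mult: "\<And>g h x. g \<in> carrier G \<Longrightarrow> h \<in> carrier G \<Longrightarrow> act (g \<otimes> h) x = act g (act h x)"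
    and act_B: "\<And>g x y. g \<in> carrier G \<Longrightarrow> B (act g x) (act g y) = B x y"
    and act_complete: "\<And>f. (\<And>x y. f (x + y) = f x + f y) \<Longrightarrow> (\<And>c x. f (c *s x) = c *s f x) \<Longrightarrow>
       (\<And>x y. B (f x) (f y) = B x y) \<Longrightarrow> \<exists>g\<in>carrier G. \<forall>x. act g x = f x"
    and dim4: "\<exists>e1 e2 f1 f2. B e1 f1 = 1 \<and> B e2 f2 = 1 \<and> B e1 e2 = 0 \<and> B e1 f2 = 0 \<and> B e2 f1 = 0 \<and> B f1 f2 = 0
       \<and> (\<forall>x. x = B x f1 *s e1 + B x f2 *s e2 + B x e1 *s f1 + B x e2 *s f2)"
begin

lemma B_add_right: "B x (y + z) = B x y + B x z" by (metis B_add B_sym)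
lemma B_scale_right: "B x (c *s y) = c * B x y" by (metis B_scale B_sym)
lemma B_zero [simp]: "B 0 x = 0" "B x 0 = 0"
  using B_scale[of 0 x x] B_scale_right[of x 0 x] by simp_all
lemmas bilinear = B_add B_add_right B_scale B_scale_right

lemma self_add [simp]: "(c::'f) + c = 0" "c + (c + d) = d"
  using char2 by (metis mult_2 mult_zero_left) (metis char2 mult_2 mult_zero_left add.assoc add_0)
lemma self_add_v [simp]: "(x::'v) + x = 0" "x + (x + y) = y"
proof -
  show a: "x + x = 0" for x :: 'v
    using scale_left_distrib[of 1 1 x] by simp
  show "x + (x + y) = y" using a[of x] by (simp add: add.assoc[symmetric])
qed
lemma eq_iff_add: "(c::'f) = d \<longleftrightarrow> c + d = 0" "(x::'v) = y \<longleftrightarrow> x + y = 0"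
  by (metis add.right_neutral self_add(2) self_add(1)) (metis add.right_neutral self_add_v(2) self_add_v(1))
lemma act_inv [simp]: "g \<in> carrier G \<Longrightarrow> act (inv g) (act g x) = x" "g \<in> carrier G \<Longrightarrow> act g (act (inv g) x) = x"
  using act_mult[of "inv g" g x] act_mult[of g "inv g" x] by simp_all

lemma act_inject [simp]: "g \<in> carrier G \<Longrightarrow> act g x = act g y \<longleftrightarrow> x = y"
  by (metis act_inv(1))

lemma act_zero [simp]: "g \<in> carrier G \<Longrightarrow> act g 0 = 0"
  using act_scale[of g 0 0] by simp

lemma act_conj: "g \<in> carrier G \<Longrightarrow> u \<in> carrier G \<Longrightarrow> act (g \<otimes> u \<otimes> inv g) x = act g (act u (act (inv g) x))"
  by (simp add: act_mult)

lemma B_act_left: "g \<in> carrier G \<Longrightarrow> B (act g x) y = B x (act (inv g) y)"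
  using act_B[of g x "act (inv g) y"] by simp

definition symplectic_basis :: "'v \<Rightarrow> 'v \<Rightarrow> 'v \<Rightarrow> 'v \<Rightarrow> bool" where
  "symplectic_basis e1 e2 f1 f2 \<longleftrightarrow> B e1 f1 = 1 \<and> B e2 f2 = 1 \<and> B e1 e2 = 0 \<and> B e1 f2 = 0 \<and> B e2 f1 = 0 \<and> B f1 f2 = 0"

lemma symplectic_basis_B:
  assumes "symplectic_basis e1 e2 f1 f2"
  shows "B e1 f1 = 1" "B e2 f2 = 1" "B e1 e2 = 0" "B e1 f2 = 0" "B e2 f1 = 0" "B f1 f2 = 0"
    "B f1 e1 = 1" "B f2 e2 = 1" "B e2 e1 = 0" "B f2 e1 = 0" "B f1 e2 = 0" "B f2 f1 = 0"
  using assms B_sym unfolding symplectic_basis_def by metis+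

text \<open>\<open>dim4\<close> expands vectors in one particular basis only. The linear map
  carrying that basis to the given one preserves B, so it is the action of a group element; it is
  therefore invertible and transports the expansion.\<close>

lemma expand:
  assumes "symplectic_basis e1 e2 f1 f2"
  shows "x = B x f1 *s e1 + B x f2 *s e2 + B x e1 *s f1 + B x e2 *s f2"
proof -
  obtain a1 a2 b1 b2 where sb: "symplectic_basis a1 a2 b1 b2"
    and ex: "\<And>x. x = B x b1 *s a1 + B x b2 *s a2 + B x a1 *s b1 + B x a2 *s b2"
    using dim4 unfolding symplectic_basis_def by blast
  define f where "f x = B x b1 *s e1 + B x b2 *s e2 + B x a1 *s f1 + B x a2 *s f2" for x
  note sba = symplectic_basis_B[OF sb] and sbe = symplectic_basis_B[OF assms]
  have Bf: "B (f x) (f y) = B x y" for x y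
  proof -
    have "B (f x) (f y) = B x b1 * B y a1 + B x b2 * B y a2 + B x a1 * B y b1 + B x a2 * B y b2"
      unfolding f_def by (simp add: bilinear sbe algebra_simps)
    also have "\<dots> = B (B x b1 *s a1 + B x b2 *s a2 + B x a1 *s b1 + B x a2 *s b2) y"
      by (simp add: bilinear B_sym[of _ y])
    finally show ?thesis using ex[of x] by simp
  qed
  have "f (x + y) = f x + f y" "f (c *s x) = c *s f x" for c x y
    by (simp_all add: f_def bilinear scale_left_distrib scale_right_distrib algebra_simps)
  then have "\<exists>g\<in>carrier G. \<forall>x. act g x = f x" using Bf by (intro act_complete) auto
  then obtain g where g: "g \<in> carrier G" "\<And>x. act g x = f x" by blast
  have "f a1 = e1" "f a2 = e2" "f b1 = f1" "f b2 = f2" by (simp_all add: f_def sba)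
  then have inv: "act (inv g) e1 = a1" "act (inv g) e2 = a2" "act (inv g) f1 = b1" "act (inv g) f2 = b2"
    using act_inv(1)[OF g(1)] unfolding g(2) by metis+
  have "x = f (act (inv g) x)" using act_inv(2)[OF g(1), of x] unfolding g(2) by simp
  then show ?thesis using B_act_left[of "inv g"] g(1) inv unfolding f_def
    by (metis B_sym inv_closed act_B)
qed

text \<open>In characteristic 2 a hyperbolic pair can be reversed without a sign. The two reversals
  provide the flags used against a plane and against a line.\<close>

lemma symplectic_basis_swap:
  assumes "symplectic_basis e1 e2 f1 f2"
  shows "symplectic_basis f1 f2 e1 e2" "symplectic_basis f1 e2 e1 f2"
  using symplectic_basis_B[OF assms] unfolding symplectic_basis_def by auto

text \<open>If there were no such y, then \<open>B u\<close> would vanish wherever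
  \<open>B w\<close> does. Projecting an arbitrary x into the orthogonal space of w by adding
  \<open>B w x *s z\<close> then makes u a multiple of w, by nondegeneracy.\<close>

lemma ex_dual:
  assumes u: "u \<noteq> 0" and w: "\<And>c. u \<noteq> c *s w"
  obtains y where "B u y = 1" "B w y = 0"
proof (rule ccontr)
  assume "\<not> thesis"
  then have n: "\<not> (B u y = 1 \<and> B w y = 0)" for y using that by blast
  have orth: "B u y = 0" if "B w y = 0" for y
  proof (rule ccontr)
    assume "B u y \<noteq> 0"
    then show False using n[of "inverse (B u y) *s y"] that by (simp add: bilinear)
  qed
  show False
  proof (cases "\<exists>y. B w y \<noteq> 0")
    case True
    then obtain y where "B w y \<noteq> 0" by blast
    define z where "z = inverse (B w y) *s y"
    have z: "B w z = 1" using \<open>B w y \<noteq> 0\<close> by (simp add: z_def bilinear)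
    have "B (u + B u z *s w) x = 0" for x
    proof -
      have "B w (x + B w x *s z) = 0" by (simp add: bilinear z)
      then have "B u (x + B w x *s z) = 0" by (rule orth)
      then show ?thesis by (simp add: bilinear mult.commute)
    qed
    then have "u + B u z *s w = 0" by (rule B_nondegenerate)
    then have "u = B u z *s w" by (subst eq_iff_add(2))
    then show False using w by blast
  next
    case False
    then have "u = 0" using orth by (intro B_nondegenerate) auto
    then show False using u by simp
  qed
qed

lemma ex_symplectic_basis:
  assumes indep: "\<And>a b. a *s u + b *s w = 0 \<Longrightarrow> a = 0 \<and> b = 0" and uw: "B u w = 0"
  obtains f1 f2 where "symplectic_basis u w f1 f2"
proof -
  have "u \<noteq> 0" using indep[of 1 0] by auto
  moreover have "u \<noteq> c *s w" for c
  proof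
    assume "u = c *s w" then show False using indep[of 1 c] by simp
  qed
  ultimately obtain f1 where f1: "B u f1 = 1" "B w f1 = 0" by (rule ex_dual)
  have "w \<noteq> 0" using indep[of 0 1] by auto
  moreover have "w \<noteq> c *s u" for c
  proof
    assume "w = c *s u" then show False using indep[of c 1] by simp
  qed
  ultimately obtain f where f: "B w f = 1" "B u f = 0" by (rule ex_dual)
  \<comment> \<open>The multiple of u added to f makes it orthogonal to f1 because
    \<open>B u f1 = 1\<close>, and it changes no product with u or w.\<close>
  have "symplectic_basis u w f1 (f + B f1 f *s u)"
    unfolding symplectic_basis_def using f1 f uw B_sym[of w u] B_sym[of f1 u] by (simp add: bilinear)
  then show thesis by (rule that)
qed

text \<open>Split v as p + q along two orthogonal hyperbolic planes. If both parts are nonzero, p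
  itself is orthogonal to v and independent of it; if one part is zero, a basis vector of that plane
  works.\<close>

lemma ex_orthogonal:
  assumes v: "v \<noteq> 0"
  obtains w where "\<And>a b. a *s v + b *s w = 0 \<Longrightarrow> a = 0 \<and> b = 0" "B v w = 0"
proof -
  obtain e1 e2 f1 f2 where sb: "symplectic_basis e1 e2 f1 f2" using dim4 unfolding symplectic_basis_def by blast
  note b = symplectic_basis_B[OF sb]
  define p q where "p = B v f1 *s e1 + B v e1 *s f1" and "q = B v f2 *s e2 + B v e2 *s f2"
  have vpq: "v = p + q" using expand[OF sb, of v] by (simp add: p_def q_def algebra_simps)
  have pq: "B p q = 0" "B p e2 = 0" "B p f2 = 0" "B q e1 = 0" "B q f1 = 0" by (simp_all add: p_def q_def bilinear b)
  have p0: "\<exists>y. B p y \<noteq> 0 \<and> B q y = 0" if "p \<noteq> 0"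
  proof -
    have "B p e1 \<noteq> 0 \<or> B p f1 \<noteq> 0" using that by (auto simp: p_def bilinear b)
    then show ?thesis using pq by blast
  qed
  have q0: "\<exists>y. B q y \<noteq> 0 \<and> B p y = 0" if "q \<noteq> 0"
  proof -
    have "B q e2 \<noteq> 0 \<or> B q f2 \<noteq> 0" using that by (auto simp: q_def bilinear b)
    then show ?thesis using pq by blast
  qed
  consider "p \<noteq> 0" "q \<noteq> 0" | "q = 0" "p \<noteq> 0" | "p = 0" "q \<noteq> 0"
    using v vpq by (cases "p = 0"; cases "q = 0") auto
  then show thesis
  proof cases
    case 1
    then obtain y where y: "B q y \<noteq> 0" "B p y = 0" using q0 by blast
    have "a = 0 \<and> b = 0" if e: "a *s v + b *s p = 0" for a b
    proof -
      have "B (a *s v + b *s p) y = 0" using e by simp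
      then have "a = 0" using y by (simp add: bilinear vpq)
      then show ?thesis using e 1 by simp
    qed
    moreover have "B v p = 0" using pq B_sym[of q p] by (simp add: vpq bilinear)
    ultimately show ?thesis by (rule that)
  next
    case 2
    have "a = 0 \<and> c = 0" if e: "a *s v + c *s e2 = 0" for a c
    proof -
      have "B (a *s v + c *s e2) f2 = 0" using e by simp
      then have "c = 0" using 2 pq by (simp add: bilinear vpq b)
      then show ?thesis using e v by simp
    qed
    moreover have "B v e2 = 0" using 2 pq by (simp add: vpq)
    ultimately show ?thesis by (rule that)
  next
    case 3
    have "a = 0 \<and> c = 0" if e: "a *s v + c *s e1 = 0" for a c
    proof -
      have "B (a *s v + c *s e1) f1 = 0" using e by simp
      then have "c = 0" using 3 pq by (simp add: bilinear vpq b)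
      then show ?thesis using e v by simp
    qed
    moreover have "B v e1 = 0" using 3 pq by (simp add: vpq)
    ultimately show ?thesis by (rule that)
  qed
qed

section \<open>Explicit isometries: Siegel elements, transvections and torus elements\<close>

lemma ex_isometry:
  assumes "\<And>x y. f (x + y) = f x + f y" "\<And>c x. f (c *s x) = c *s f x" "\<And>x y. B (f x) (f y) = B x y"
  obtains g where "g \<in> carrier G" "\<And>v. act g v = f v"
  using act_complete[of f] assms by blast

text \<open>With p = q the two terms cancel in characteristic 2, so transvections have to be
  constructed on their own.\<close>

lemma ex_siegel:
  assumes "B p q = 0"
  obtains g where "g \<in> carrier G" "\<And>v. act g v = v + c *s (B v p *s q + B v q *s p)"
proof (rule ex_isometry[of "\<lambda>v. v + c *s (B v p *s q + B v q *s p)"])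
  show "B (x + c *s (B x p *s q + B x q *s p)) (y + c *s (B y p *s q + B y q *s p)) = B x y" for x y
    using assms B_sym[of q p] by (simp add: bilinear B_sym[of p y] B_sym[of q y] algebra_simps)
qed (simp_all add: bilinear scale_left_distrib scale_right_distrib ac_simps distrib_left distrib_right that)

lemma ex_transvection:
  obtains g where "g \<in> carrier G" "\<And>v. act g v = v + (c * B v p) *s p"
proof (rule ex_isometry[of "\<lambda>v. v + (c * B v p) *s p"])
  show "B (x + (c * B x p) *s p) (y + (c * B y p) *s p) = B x y" for x y
    by (simp add: bilinear B_sym[of p y] algebra_simps)
qed (simp_all add: bilinear scale_left_distrib scale_right_distrib ac_simps distrib_left distrib_right that)

text \<open>The torus element that scales x by t and y by s and fixes the orthogonal complement of
  the pair; \<open>t + 1\<close> stands for t - 1.\<close>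

lemma ex_hyperbolic:
  assumes xy: "B x y = 1" and ts: "t * s = 1"
  obtains g where "g \<in> carrier G" "\<And>v. act g v = v + ((t + 1) * B v y) *s x + ((s + 1) * B v x) *s y"
proof (rule ex_isometry[of "\<lambda>v. v + ((t + 1) * B v y) *s x + ((s + 1) * B v x) *s y"])
  have ts': "t * (s * c) = c" "s * (t * c) = c" for c using ts by (simp_all add: mult.assoc[symmetric] mult.commute[of s])
  show "B (v + ((t + 1) * B v y) *s x + ((s + 1) * B v x) *s y) (w + ((t + 1) * B w y) *s x + ((s + 1) * B w x) *s y)
      = B v w" for v w
    using xy B_sym[of y x] by (simp add: bilinear B_sym[of x w] B_sym[of y w] ts ts' algebra_simps)
qed (simp_all add: bilinear scale_left_distrib scale_right_distrib ac_simps distrib_left distrib_right that)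

section \<open>Borel subgroups as flag stabilizers\<close>

definition flag_group :: "'v \<Rightarrow> 'v \<Rightarrow> 'g set" where
  "flag_group x z = {g \<in> carrier G. (\<exists>c. act g x = c *s x) \<and> (\<exists>c d. act g z = c *s z + d *s x)}"

text \<open>For a symplectic basis x, z, x', z' the two forms read off the diagonal entries of the
  triangular action on x, z: a character of the maximal torus inflated to the Borel
  subgroup.\<close>

definition flag_char :: "('f \<Rightarrow> complex) \<Rightarrow> ('f \<Rightarrow> complex) \<Rightarrow> 'v \<Rightarrow> 'v \<Rightarrow> 'v \<Rightarrow> 'v \<Rightarrow> 'g \<Rightarrow> complex" where
  "flag_char \<theta>1 \<theta>2 x z x' z' g = \<theta>1 (B (act g x) x') * \<theta>2 (B (act g z) z')"

lemma flag_char_eq: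
  assumes "symplectic_basis x z x' z'" "act g x = c1 *s x" "act g z = c2 *s z + d *s x"
  shows "flag_char \<theta>1 \<theta>2 x z x' z' g = \<theta>1 c1 * \<theta>2 c2"
  using assms(2,3) symplectic_basis_B[OF assms(1)] by (simp add: flag_char_def bilinear)

lemma flag_eigenvalues_nonzero:
  assumes sb: "symplectic_basis x z x' z'" and g: "g \<in> carrier G"
    "act g x = c1 *s x" "act g z = c2 *s z + d *s x"
  shows "c1 \<noteq> 0" "c2 \<noteq> 0"
proof -
  note b = symplectic_basis_B[OF sb]
  show c1: "c1 \<noteq> 0"
  proof
    assume "c1 = 0"
    then have "act g x = act g 0" using g by simp
    then have "x = 0" using g(1) by (simp only: act_inject)
    then show False using b by simp
  qed
  show "c2 \<noteq> 0"
  proof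
    assume "c2 = 0"
    then have "act g (c1 *s z) = act g (d *s x)" using g by (simp add: act_scale mult.commute)
    then have "c1 *s z = d *s x" using g(1) by (simp only: act_inject)
    then have "B (c1 *s z) z' = B (d *s x) z'" by simp
    then show False using b c1 by (simp add: bilinear)
  qed
qed

lemma linear_character_flag:
  assumes sb: "symplectic_basis x z x' z'" and "mult_character \<theta>1" "mult_character \<theta>2"
  shows "linear_character G (flag_group x z) (flag_char \<theta>1 \<theta>2 x z x' z')"
proof (rule linear_characterI)
  have mult: "g \<otimes> h \<in> flag_group x z \<and> flag_char \<theta>1 \<theta>2 x z x' z' (g \<otimes> h)
      = flag_char \<theta>1 \<theta>2 x z x' z' g * flag_char \<theta>1 \<theta>2 x z x' z' h"
    if gh: "g \<in> flag_group x z" "h \<in> flag_group x z" for g h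
  proof -
    obtain c1 c2 d where g: "g \<in> carrier G" "act g x = c1 *s x" "act g z = c2 *s z + d *s x"
      using gh(1) by (auto simp: flag_group_def)
    obtain c1' c2' d' where h: "h \<in> carrier G" "act h x = c1' *s x" "act h z = c2' *s z + d' *s x"
      using gh(2) by (auto simp: flag_group_def)
    have 1: "act (g \<otimes> h) x = (c1 * c1') *s x"
      using g h by (simp add: act_mult act_scale mult.commute)
    have 2: "act (g \<otimes> h) z = (c2 * c2') *s z + (c2' * d + d' * c1) *s x"
      using g h by (simp add: act_mult act_scale act_add scale_right_distrib scale_left_distrib ac_simps)
    note nz = flag_eigenvalues_nonzero[OF sb g] flag_eigenvalues_nonzero[OF sb h]
    show ?thesis
      unfolding flag_char_eq[OF sb 1 2] flag_char_eq[OF sb g(2,3)] flag_char_eq[OF sb h(2,3)]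
      using assms(2,3) nz 1 2 g(1) h(1) unfolding mult_character_def flag_group_def by auto
  qed
  show "subgroup (flag_group x z) G"
    using mult by (intro subgroupI_finite) (auto simp: flag_group_def intro: exI[of _ 1] exI[of _ 0])
  show "flag_char \<theta>1 \<theta>2 x z x' z' \<one> = 1"
    using assms(2,3) symplectic_basis_B[OF sb] by (simp add: flag_char_def mult_character_def)
  show "flag_char \<theta>1 \<theta>2 x z x' z' (g \<otimes> h) = flag_char \<theta>1 \<theta>2 x z x' z' g * flag_char \<theta>1 \<theta>2 x z x' z' h"
    if "g \<in> flag_group x z" "h \<in> flag_group x z" for g h
    using mult that by blast
qed

text \<open>For two distinct flags a torus element stabilising both, supported on a hyperbolic pair
  \<open>x, y\<close>, acts on them with different eigenvalues; this plays the role of the Bruhat decomposition.\<close>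

lemma mackey_irreducible_flag:
  assumes sb: "symplectic_basis x z xs zs"
    and \<theta>: "mult_character \<theta>1" "mult_character \<theta>2" and t: "t \<noteq> 0"
    and reg: "\<theta>1 t * \<theta>1 t \<noteq> 1" "\<theta>2 t * \<theta>2 t \<noteq> 1" "\<theta>1 t \<noteq> \<theta>2 t" "\<theta>1 t * \<theta>2 t \<noteq> 1"
  shows "mackey_irreducible G (carrier G) (flag_group x z) (flag_char \<theta>1 \<theta>2 x z xs zs)"
  unfolding mackey_irreducible_def
proof
  fix g assume "g \<in> carrier G - flag_group x z"
  then have g: "g \<in> carrier G" and gnot: "g \<notin> flag_group x z" by auto
  note b = symplectic_basis_B[OF sb]
  define x' z' where "x' = act g x" and "z' = act g z"
  let ?P = "\<exists>u\<in>flag_group x z. g \<otimes> u \<otimes> inv g \<in> flag_group x z \<and>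
     flag_char \<theta>1 \<theta>2 x z xs zs (g \<otimes> u \<otimes> inv g) \<noteq> flag_char \<theta>1 \<theta>2 x z xs zs u"
  \<comment> \<open>Mackey's condition at g asks for some h preserving both the flag of x, z and its
    image under g, with different character values on the two; then u is the conjugate of h back by
    g.\<close>
  have sep: ?P if h: "h \<in> carrier G" "act h x = c1 *s x" "act h z = c2 *s z + d *s x"
      "act h x' = c1' *s x'" "act h z' = c2' *s z' + d' *s x'" and ne: "\<theta>1 c1 * \<theta>2 c2 \<noteq> \<theta>1 c1' * \<theta>2 c2'"
    for h c1 c2 d c1' c2' d'
  proof -
    define u where "u = inv g \<otimes> h \<otimes> g"
    have u: "u \<in> carrier G" using g h by (simp add: u_def)
    have guh: "g \<otimes> u \<otimes> inv g = h"
    proof -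
      have "g \<otimes> (inv g \<otimes> h) = h" using g h by (simp add: m_assoc[symmetric])
      then show ?thesis using g h by (simp add: u_def m_assoc)
    qed
    have ux: "act u x = c1' *s x" "act u z = c2' *s z + d' *s x"
      using g h by (simp_all add: u_def act_mult x'_def z'_def act_scale act_add)
    show ?thesis
    proof (rule bexI[of _ u], unfold guh flag_char_eq[OF sb ux] flag_char_eq[OF sb h(2,3)], intro conjI)
      show "h \<in> flag_group x z" "u \<in> flag_group x z" using h u ux by (auto simp: flag_group_def)
    qed (rule ne)
  qed
  define s where "s = inverse t"
  have ts: "t * s = 1" and st: "s * t = 1" and s0: "s \<noteq> 0" using t by (simp_all add: s_def)
  have one: "\<theta>1 1 = 1" "\<theta>2 1 = 1" using \<theta> by (simp_all add: mult_character_def)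
  have inv_\<theta>: "\<theta>1 t * \<theta>1 s = 1" "\<theta>2 t * \<theta>2 s = 1"
    using \<theta> ts t s0 one unfolding mult_character_def by metis+
  have ne: "\<theta>1 t \<noteq> \<theta>1 s" "\<theta>2 t \<noteq> \<theta>2 s" "\<theta>1 t \<noteq> \<theta>2 s"
    using reg inv_\<theta> by (metis, metis, metis mult.commute)
  have xz': "B x' z' = 0" "B z' x' = 0" using b g by (simp_all add: x'_def z'_def act_B)
  have x'0: "x' \<noteq> 0"
  proof
    assume "x' = 0"
    then have "act g x = act g 0" using g by (simp add: x'_def)
    then have "x = 0" using g by (simp only: act_inject)
    then show False using b by simp
  qed
  have one_plus: "v + (t + 1) *s v = t *s v" "v + (s + 1) *s v = s *s v" for v
    by (simp_all add: scale_left_distrib add.commute[of "_ *s v" v])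
  show ?P
  proof (cases "B x x' = 0")
    case False
    \<comment> \<open>The lines x and x' span a hyperbolic plane. The element h scales them by t and
      s and fixes z and z' modulo x and x', so that the values are \<open>\<theta>1 t\<close> and
      \<open>\<theta>1 s\<close>.\<close>
    define y where "y = inverse (B x x') *s x'"
    have xy: "B x y = 1" "B y x = 1" using False B_sym[of x' x] by (simp_all add: y_def bilinear)
    have x'y: "x' = B x x' *s y" using False by (simp add: y_def)
    have y0: "B z' y = 0" using xz' by (simp add: y_def bilinear)
    obtain h where h: "h \<in> carrier G" "\<And>v. act h v = v + ((t + 1) * B v y) *s x + ((s + 1) * B v x) *s y"
      using ex_hyperbolic[OF xy(1) ts] by blast
    have "act h y = s *s y" using h(2)[of y] xy one_plus by simp
    then have 3: "act h x' = s *s x'" using act_scale[OF h(1), of "B x x'" y] x'y by (metis scale_left_commute)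
    have "act h z' = z' + ((s + 1) * B z' x) *s (inverse (B x x') *s x')" using h(2)[of z'] y0 by (simp add: y_def)
    then have 4: "act h z' = 1 *s z' + ((s + 1) * B z' x * inverse (B x x')) *s x'" by simp
    show ?thesis
      by (rule sep[OF h(1) _ _ 3 4, of t 1 "(t + 1) * B z y"])
        (use h(2)[of x] h(2)[of z] xy one_plus b ne in \<open>simp_all add: one\<close>)
  next
    case xx': True
    show ?thesis
    proof (cases "\<exists>c. x' = c *s x")
      case False
      have indep: "x \<noteq> 0" "x \<noteq> c *s x'" for c
      proof -
        show x0: "x \<noteq> 0" using b by auto
        show "x \<noteq> c *s x'"
        proof
          assume e: "x = c *s x'"
          then have "c \<noteq> 0" using x0 by auto
          then have "x' = inverse c *s x" using e by simp
          then show False using False by blast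
        qed
      qed
      \<comment> \<open>Orthogonality of y to x' makes h fix x'. If z' is orthogonal to x, it lies
        in the plane of x and x', so h scales it by t modulo x'; otherwise y must be a multiple of
        z', and h scales z' by s. The value \<open>\<theta>1 t\<close> is thus compared with
        \<open>\<theta>2 t\<close> or \<open>\<theta>2 s\<close>.\<close>
      obtain y where y: "B x y = 1" "B x' y = 0" and z'y: "B z' x = 0 \<or> z' = B x z' *s y"
      proof (cases "B z' x = 0")
        case True
        then show thesis using ex_dual[OF indep] that by blast
      next
        case False
        then have "B x z' \<noteq> 0" by (simp add: B_sym[of x z'])
        then show thesis using that[of "inverse (B x z') *s z'"] xz' by (simp add: bilinear)
      qed
      have yx: "B y x = 1" using y B_sym[of y x] by simp
      have x'x: "B x' x = 0" using xx' B_sym[of x' x] by simp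
      obtain h where h: "h \<in> carrier G" "\<And>v. act h v = v + ((t + 1) * B v y) *s x + ((s + 1) * B v x) *s y"
        using ex_hyperbolic[OF y(1) ts] by blast
      have 1: "act h x = t *s x" using h(2)[of x] y one_plus by simp
      have 2: "act h z = 1 *s z + ((t + 1) * B z y) *s x" using h(2)[of z] b by simp
      have 3: "act h x' = 1 *s x'" using h(2)[of x'] y x'x by simp
      show ?thesis
      proof (cases "B z' x = 0")
        case True
        have "a = 0 \<and> c = 0" if e: "a *s x + c *s x' = 0" for a c
        proof -
          have "B (a *s x + c *s x') y = 0" using e by simp
          then have "a = 0" using y by (simp add: bilinear)
          then show ?thesis using e x'0 by simp
        qed
        then obtain f1 f2 where sb': "symplectic_basis x x' f1 f2" using ex_symplectic_basis[of x x'] xx' by blast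
        have z'eq: "z' = B z' f1 *s x + B z' f2 *s x'"
          using expand[OF sb', of z'] True xz' by simp
        then obtain \<alpha> \<beta> where z'eq: "z' = \<alpha> *s x + \<beta> *s x'" by blast
        have "act h z' = t *s z' + ((t + 1) * \<beta>) *s x'"
          using h(1) 1 3 unfolding z'eq
          by (simp add: act_add act_scale scale_right_distrib scale_left_distrib distrib_left distrib_right ac_simps)
        from sep[OF h(1) 1 2 3 this] show ?thesis using reg one by simp
      next
        case False
        then have z'e: "z' = B x z' *s y" using z'y by simp
        have "act h y = s *s y" using h(2)[of y] yx one_plus by simp
        then have "act h z' = s *s z' + 0 *s x'" using act_scale[OF h(1), of "B x z'" y] z'e
          by (metis scale_left_commute scale_zero_left add.right_neutral)
        from sep[OF h(1) 1 2 3 this] show ?thesis using ne one by simp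
      qed
    next
      case True
      then obtain c where c: "x' = c *s x" by blast
      have c0: "c \<noteq> 0" using c x'0 by auto
      have z'x: "B z' x = 0" using xz' c c0 by (simp add: bilinear)
      \<comment> \<open>The lines agree, so the planes differ. As z' is orthogonal to x,
        orthogonality to z would put it into the plane of x and z. Hence z and z' span a hyperbolic
        plane, where \<open>\<theta>2 t\<close> and \<open>\<theta>2 s\<close> are compared.\<close>
      have zz': "B z z' \<noteq> 0"
      proof
        assume "B z z' = 0"
        then have "z' = B z' zs *s z + B z' xs *s x"
          using expand[OF sb, of z'] z'x B_sym[of z' z] by (simp add: add.commute)
        then have "g \<in> flag_group x z" using g c unfolding x'_def z'_def flag_group_def by blast
        then show False using gnot by simp
      qed
      define y where "y = inverse (B z z') *s z'"
      have y: "B z y = 1" "B y z = 1" "B x y = 0" using zz' z'x B_sym[of z' z] B_sym[of x z'] by (simp_all add: y_def bilinear)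
      obtain h where h: "h \<in> carrier G" "\<And>v. act h v = v + ((t + 1) * B v y) *s z + ((s + 1) * B v z) *s y"
        using ex_hyperbolic[OF y(1) ts] by blast
      have 1: "act h x = 1 *s x" using h(2)[of x] y b by simp
      have 2: "act h z = t *s z + 0 *s x" using h(2)[of z] y one_plus by simp
      have 3: "act h x' = 1 *s x'" using 1 c act_scale[OF h(1)] by simp
      have "act h y = s *s y" using h(2)[of y] y one_plus by simp
      moreover have z'y: "z' = B z z' *s y" using zz' by (simp add: y_def)
      ultimately have 4: "act h z' = s *s z' + 0 *s x'" using act_scale[OF h(1), of "B z z'" y]
          by (metis scale_left_commute scale_zero_left add.right_neutral)
      from sep[OF h(1) 1 2 3 4] show ?thesis using ne one by simp
    qed
  qed
qed

end

section \<open>Torus characters and additive characters in characteristic 2\<close>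

locale char2_symplectic_chars = char2_symplectic G scale act B
  for G :: "('g,'m) monoid_scheme" (structure)
    and scale :: "'f::{finite,field} \<Rightarrow> 'v::ab_group_add \<Rightarrow> 'v" (infixr "*s" 75)
    and act :: "'g \<Rightarrow> 'v \<Rightarrow> 'v" and B :: "'v \<Rightarrow> 'v \<Rightarrow> 'f" +
  fixes \<theta> :: "'f \<Rightarrow> complex" and \<phi> :: "'f \<Rightarrow> complex" and t0 c0 :: 'f
  assumes \<theta>: "mult_character \<theta>" and t0: "t0 \<noteq> 0"
    and \<theta>_t0: "\<theta> t0 ^ 2 \<noteq> 1" "\<theta> t0 ^ 3 \<noteq> 1" "\<theta> t0 ^ 4 \<noteq> 1"
    and \<phi>_add: "\<And>x y. \<phi> (x + y) = \<phi> x * \<phi> y" and \<phi>_zero [simp]: "\<phi> 0 = 1"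
    and \<phi>_square: "\<And>x. (\<phi> x)\<^sup>2 = 1" and \<phi>_c0: "\<phi> c0 \<noteq> 1"
begin

lemma \<theta>_one [simp]: "\<theta> 1 = 1" and \<theta>_mult: "x \<noteq> 0 \<Longrightarrow> y \<noteq> 0 \<Longrightarrow> \<theta> (x * y) = \<theta> x * \<theta> y"
  using \<theta> by (auto simp: mult_character_def)

lemma \<theta>_inverse_pair: assumes "t * s = 1" shows "\<theta> t * \<theta> s = 1" "\<theta> s * \<theta> t = 1"
proof -
  have "t \<noteq> 0" "s \<noteq> 0" using assms by auto
  then show "\<theta> t * \<theta> s = 1" "\<theta> s * \<theta> t = 1" using \<theta>_mult[of t s] assms by (simp_all add: mult.commute)
qed

lemma \<phi>_nontrivial: "a \<noteq> 0 \<Longrightarrow> \<exists>c. \<phi> (c * a) \<noteq> 1"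
  using \<phi>_c0 by (intro exI[of _ "c0 * inverse a"]) (simp add: mult.assoc)

text \<open>Nontriviality of \<phi> at a multiple of a + 1 suffices, since the values of \<phi> are
  signs: a product of two of them differs from 1 only if they differ.\<close>

lemma \<phi>_separates: assumes "a \<noteq> 1" shows "\<exists>c. \<phi> (c * a) \<noteq> \<phi> c"
proof -
  have "a + 1 \<noteq> 0" using assms eq_iff_add(1)[of a 1] by simp
  then obtain c where c: "\<phi> (c * (a + 1)) \<noteq> 1" using \<phi>_nontrivial by blast
  have "c * (a + 1) = c * a + c" by (simp add: distrib_left)
  then have "\<phi> (c * a) * \<phi> c \<noteq> 1" using c \<phi>_add by metis
  then show ?thesis using \<phi>_square[of c] by (metis power2_eq_square)
qed

text \<open>The Frobenius map is additive. This is what makes the isotropy group of the second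
  double coset trivial.\<close>

lemma square_eq_one: assumes "(t::'f) * t = 1" shows "t = 1"
proof -
  have "(t + 1) * (t + 1) = 0" using assms by (simp add: distrib_left distrib_right ac_simps)
  then show ?thesis using eq_iff_add(1)[of t 1] by simp
qed

text \<open>The Frobenius map is injective on a finite set. Square roots are needed because
  \<open>line_char\<close> is quadratic in some coordinates of the radical.\<close>

lemma ex_square_root: "\<exists>c::'f. c * c = a"
proof -
  have "inj (\<lambda>c::'f. c * c)"
  proof (rule injI)
    fix x y :: 'f assume "x * x = y * y"
    then have "(x + y) * (x + y) = 0" by (simp add: distrib_left distrib_right ac_simps)
    then show "x = y" using eq_iff_add(1)[of x y] by simp
  qed
  then have "surj (\<lambda>c::'f. c * c)" by (simp add: finite_UNIV_inj_surj)
  from surjD[OF this, of a] show ?thesis by (auto intro: sym)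
qed

text \<open>Squaring removes the sign \<open>\<phi> r\<close> and leaves
  \<open>\<theta> t0 ^ 4 = 1\<close>. It is stated for every r because conjugation by a swap inverts
  the torus parameter but brings in a unipotent part that need not be computed.\<close>

lemma \<theta>_t0_square_ne: "t0 * s = 1 \<Longrightarrow> \<theta> s * \<phi> r \<noteq> \<theta> t0"
proof
  assume ts: "t0 * s = 1" and e: "\<theta> s * \<phi> r = \<theta> t0"
  have "\<theta> t0 ^ 4 = (\<theta> t0)\<^sup>2 * (\<theta> s * \<phi> r)\<^sup>2" unfolding e by (simp add: power_add[symmetric])
  also have "\<dots> = (\<theta> t0 * \<theta> s)\<^sup>2" by (simp add: power_mult_distrib \<phi>_square)
  also have "\<dots> = 1" using \<theta>_inverse_pair[OF ts] by simp
  finally show False using \<theta>_t0(3) by simp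
qed

definition set_stabilizer :: "'v set \<Rightarrow> 'g set" where
  "set_stabilizer W = {g \<in> carrier G. act g ` W = W}"

lemma subgroup_set_stabilizer: "subgroup (set_stabilizer W) G"
proof (rule subgroupI_finite)
  show "g \<otimes> h \<in> set_stabilizer W" if "g \<in> set_stabilizer W" "h \<in> set_stabilizer W" for g h
  proof -
    have "act (g \<otimes> h) ` W = act g ` act h ` W"
      using that unfolding image_image by (intro image_cong) (auto simp: set_stabilizer_def act_mult)
    then show ?thesis using that by (simp add: set_stabilizer_def)
  qed
qed (auto simp: set_stabilizer_def)

lemma set_stabilizerI:
  assumes "finite W" "g \<in> carrier G" "\<And>w. w \<in> W \<Longrightarrow> act g w \<in> W"
  shows "g \<in> set_stabilizer W"
proof -
  have "inj_on (act g) W" using assms(2) by (auto intro: inj_onI)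
  then have "act g ` W = W" using assms by (intro endo_inj_surj) auto
  then show ?thesis using assms(2) by (simp add: set_stabilizer_def)
qed

lemma act_conj_transvection:
  assumes "g \<in> carrier G" "u \<in> carrier G" "\<And>v. act u v = v + (c * B v p) *s p"
  shows "act (g \<otimes> u \<otimes> inv g) v = v + (c * B v (act g p)) *s act g p"
  using assms B_act_left[of "inv g" v p] by (simp add: act_conj act_add act_scale)

lemma act_conj_siegel:
  assumes "g \<in> carrier G" "u \<in> carrier G" "\<And>v. act u v = v + c *s (B v p *s q + B v q *s p)"
  shows "act (g \<otimes> u \<otimes> inv g) v = v + c *s (B v (act g p) *s act g q + B v (act g q) *s act g p)"
  using assms B_act_left[of "inv g" v p] B_act_left[of "inv g" v q] by (simp add: act_conj act_add act_scale)

section \<open>The stabilizer of an isotropic plane\<close>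

text \<open>In block form with respect to \<open>e1, e2, f1, f2\<close>, an element of the group below is
  $\mathrm{diag}(t, t^{-1}, t^{-1}, t)$ times a unipotent matrix with a symmetric block \<open>S\<close>, and the character is
  $\theta(t)\,\phi(S_{12})$.\<close>

definition plane_torus_group :: "'v \<Rightarrow> 'v \<Rightarrow> 'g set" where
  "plane_torus_group e1 e2 = {g \<in> carrier G. \<exists>t s. t * s = 1 \<and> act g e1 = t *s e1 \<and> act g e2 = s *s e2}"

definition plane_char :: "'v \<Rightarrow> 'v \<Rightarrow> 'v \<Rightarrow> 'g \<Rightarrow> complex" where
  "plane_char e1 f1 f2 g = \<theta> (B (act g e1) f1) * \<phi> (B (act g e1) f1 * B (act g f1) f2)"

context
  fixes e1 e2 f1 f2 :: 'v
  assumes sb: "symplectic_basis e1 e2 f1 f2"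
begin

private lemmas b = symplectic_basis_B[OF sb]

text \<open>Invariance of B against e1 and e2 determines the components of \<open>act k f1\<close>
  and \<open>act k f2\<close> along f1 and f2.\<close>

lemma plane_torus_groupE:
  assumes "k \<in> plane_torus_group e1 e2"
  obtains t s p r p' r' where "k \<in> carrier G" "t * s = 1" "act k e1 = t *s e1" "act k e2 = s *s e2"
    "act k f1 = s *s f1 + p *s e1 + r *s e2" "act k f2 = t *s f2 + p' *s e1 + r' *s e2"
    "plane_char e1 f1 f2 k = \<theta> t * \<phi> (t * r)"
proof -
  obtain t s where k: "k \<in> carrier G" "t * s = 1" "act k e1 = t *s e1" "act k e2 = s *s e2"
    using assms by (auto simp: plane_torus_group_def)
  have st: "s * t = 1" using k(2) by (simp add: mult.commute)
  have a: "t * B (act k y) e1 = B y e1" "s * B (act k y) e2 = B y e2" for y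
    using act_B[OF k(1), of y e1] act_B[OF k(1), of y e2] k by (simp_all add: bilinear)
  have c: "B (act k y) e1 = s * B y e1" "B (act k y) e2 = t * B y e2" for y
    using arg_cong[OF a(1)[of y], of "\<lambda>z. s * z"] arg_cong[OF a(2)[of y], of "\<lambda>z. t * z"] k(2) st
    by (simp_all only: mult.assoc[symmetric] mult_1)
  have 1: "act k f1 = s *s f1 + B (act k f1) f1 *s e1 + B (act k f1) f2 *s e2"
    using expand[OF sb, of "act k f1"] by (simp add: c b ac_simps)
  have 2: "act k f2 = t *s f2 + B (act k f2) f1 *s e1 + B (act k f2) f2 *s e2"
    using expand[OF sb, of "act k f2"] by (simp add: c b ac_simps)
  show thesis
    by (rule that[OF k 1 2]) (simp add: plane_char_def k(3) bilinear b)
qed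

lemma plane_char_eq:
  "act k e1 = t *s e1 \<Longrightarrow> plane_char e1 f1 f2 k = \<theta> t * \<phi> (t * B (act k f1) f2)"
  by (simp add: plane_char_def bilinear b)

lemma linear_character_plane: "linear_character G (plane_torus_group e1 e2) (plane_char e1 f1 f2)"
proof -
  have mult: "g \<otimes> h \<in> plane_torus_group e1 e2 \<and>
      plane_char e1 f1 f2 (g \<otimes> h) = plane_char e1 f1 f2 g * plane_char e1 f1 f2 h"
    if gh: "g \<in> plane_torus_group e1 e2" "h \<in> plane_torus_group e1 e2" for g h
  proof -
    obtain t s p r p' r' where g: "g \<in> carrier G" "t * s = 1" "act g e1 = t *s e1" "act g e2 = s *s e2"
      "act g f1 = s *s f1 + p *s e1 + r *s e2" "act g f2 = t *s f2 + p' *s e1 + r' *s e2"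
      "plane_char e1 f1 f2 g = \<theta> t * \<phi> (t * r)" using plane_torus_groupE[OF gh(1)] .
    obtain t' s' q m q' m' where h: "h \<in> carrier G" "t' * s' = 1" "act h e1 = t' *s e1" "act h e2 = s' *s e2"
      "act h f1 = s' *s f1 + q *s e1 + m *s e2" "act h f2 = t' *s f2 + q' *s e1 + m' *s e2"
      "plane_char e1 f1 f2 h = \<theta> t' * \<phi> (t' * m)" using plane_torus_groupE[OF gh(2)] .
    have 1: "act (g \<otimes> h) e1 = (t * t') *s e1" "act (g \<otimes> h) e2 = (s * s') *s e2"
      using g(1-4) h(1-4) by (simp_all add: act_mult act_scale mult.commute)
    have one: "(t * t') * (s * s') = (t * s) * (t' * s')" by (simp only: ac_simps)
    \<comment> \<open>The raw coordinate is additive only up to the torus scalars; the factor t in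
      \<open>plane_char\<close> corrects this, because \<open>t * s = 1\<close>.\<close>
    have "B (act (g \<otimes> h) f1) f2 = s' * r + m * s"
      using g(1,3-6) h(1,5) by (simp add: act_mult act_add act_scale bilinear b)
    then have "t * t' * B (act (g \<otimes> h) f1) f2 = (t' * s') * (t * r) + (t * s) * (t' * m)"
      by (simp add: distrib_left ac_simps)
    then have "t * t' * B (act (g \<otimes> h) f1) f2 = t * r + t' * m" using g(2) h(2) by simp
    moreover have "t \<noteq> 0" "t' \<noteq> 0" using g(2) h(2) by auto
    ultimately show ?thesis using 1 one g h
      by (auto simp: plane_torus_group_def plane_char_eq[OF 1(1)] \<theta>_mult \<phi>_add)
  qed
  show ?thesis
  proof (rule linear_characterI)
    show "subgroup (plane_torus_group e1 e2) G"
      using mult by (intro subgroupI_finite) (auto simp: plane_torus_group_def intro: exI[of _ 1])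
    show "plane_char e1 f1 f2 \<one> = 1" by (simp add: plane_char_def b)
    show "plane_char e1 f1 f2 (g \<otimes> h) = plane_char e1 f1 f2 g * plane_char e1 f1 f2 h"
      if "g \<in> plane_torus_group e1 e2" "h \<in> plane_torus_group e1 e2" for g h
      using mult that by blast
  qed
qed

text \<open>Let g act on the plane with coefficients a, b' and c, d. The radical part of the
  character is preserved only if \<open>a * b' = 0\<close>, \<open>c * d = 0\<close> and
  \<open>a * d + b' * c = 1\<close>, so that g acts by a diagonal matrix, which puts it in K, or by
  an antidiagonal one. The latter preserves every character value on the radical and is detected on
  the torus instead.\<close>

lemma mackey_irreducible_plane:
  "mackey_irreducible G (set_stabilizer {a *s e1 + c *s e2 | a c. True}) (plane_torus_group e1 e2) (plane_char e1 f1 f2)"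
  unfolding mackey_irreducible_def
proof
  let ?K = "plane_torus_group e1 e2" and ?\<mu> = "plane_char e1 f1 f2" and ?W = "{a *s e1 + c *s e2 | a c. True}"
  fix g assume gH: "g \<in> set_stabilizer ?W - ?K"
  then have g: "g \<in> carrier G" and gK: "g \<notin> ?K" and "act g ` ?W = ?W"
    unfolding set_stabilizer_def by blast+
  then have gW: "\<And>w. w \<in> ?W \<Longrightarrow> act g w \<in> ?W" by blast
  have "e1 = 1 *s e1 + 0 *s e2" "e2 = 0 *s e1 + 1 *s e2" by simp_all
  then have "e1 \<in> ?W" "e2 \<in> ?W" by blast+
  then have "act g e1 \<in> ?W" "act g e2 \<in> ?W" using gW by blast+
  then obtain a b' c d where ge: "act g e1 = a *s e1 + b' *s e2" "act g e2 = c *s e1 + d *s e2" by blast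
  let ?P = "\<exists>u\<in>?K. g \<otimes> u \<otimes> inv g \<in> ?K \<and> ?\<mu> (g \<otimes> u \<otimes> inv g) \<noteq> ?\<mu> u"
  have KI: "k \<in> ?K" if "k \<in> carrier G" "act k e1 = e1" "act k e2 = e2" for k
    using that by (auto simp: plane_torus_group_def intro!: exI[of _ 1])
  have \<mu>I: "?\<mu> k = \<phi> (B (act k f1) f2)" if "act k e1 = e1" for k
    using plane_char_eq[of k 1] that by simp
  \<comment> \<open>For p = e1 or e2 the transvection has off-diagonal entry 0, while its conjugate
    has entry \<open>x * (\<alpha> * \<beta>)\<close>.\<close>
  have transvection_case: ?P
    if p: "B p e1 = 0" "B p e2 = 0" "B f1 p * B p f2 = 0" "act g p = \<alpha> *s e1 + \<beta> *s e2" and ne: "\<alpha> * \<beta> \<noteq> 0" for p \<alpha> \<beta>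
  proof -
    obtain x where x: "\<phi> (x * (\<alpha> * \<beta>)) \<noteq> 1" using \<phi>_nontrivial[OF ne] by blast
    obtain u where u: "u \<in> carrier G" "\<And>v. act u v = v + (x * B v p) *s p" using ex_transvection by blast
    have u1: "act u e1 = e1" "act u e2 = e2" using u p B_sym by simp_all
    note gu = act_conj_transvection[OF g u, unfolded p(4)]
    have u2: "act (g \<otimes> u \<otimes> inv g) e1 = e1" "act (g \<otimes> u \<otimes> inv g) e2 = e2"
      unfolding gu by (simp_all add: bilinear b)
    have "?\<mu> u = 1" using p(3) unfolding \<mu>I[OF u1(1)] by (auto simp: u bilinear b)
    moreover have "?\<mu> (g \<otimes> u \<otimes> inv g) = \<phi> (x * (\<alpha> * \<beta>))"
      unfolding \<mu>I[OF u2(1)] gu by (simp add: bilinear b mult.assoc)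
    ultimately show ?thesis using KI[OF u(1) u1] KI[OF _ u2] u g x by (intro bexI[of _ u]) auto
  qed
  \<comment> \<open>The Siegel element of e1 and e2 has off-diagonal entry x, and conjugation
    multiplies this entry by the determinant.\<close>
  have siegel_case: ?P if ne: "a * d + b' * c \<noteq> 1"
  proof -
    obtain x where x: "\<phi> (x * (a * d + b' * c)) \<noteq> \<phi> x" using \<phi>_separates[OF ne] by blast
    obtain u where u: "u \<in> carrier G" "\<And>v. act u v = v + x *s (B v e1 *s e2 + B v e2 *s e1)"
      using ex_siegel[OF b(3)] by blast
    have u1: "act u e1 = e1" "act u e2 = e2" using u b by simp_all
    note gu = act_conj_siegel[OF g u, unfolded ge]
    have u2: "act (g \<otimes> u \<otimes> inv g) e1 = e1" "act (g \<otimes> u \<otimes> inv g) e2 = e2"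
      unfolding gu by (simp_all add: bilinear b)
    have "?\<mu> u = \<phi> x" unfolding \<mu>I[OF u1(1)] by (simp add: u bilinear b)
    moreover have "?\<mu> (g \<otimes> u \<otimes> inv g) = \<phi> (x * (a * d + b' * c))"
      unfolding \<mu>I[OF u2(1)] gu by (simp add: bilinear b mult.commute)
    ultimately show ?thesis using KI[OF u(1) u1] KI[OF _ u2] u g x by (intro bexI[of _ u]) auto
  qed
  have swap_case: ?P if sw: "a = 0" "d = 0" "b' * c = 1"
  proof -
    define s0 where "s0 = inverse t0"
    have ts: "t0 * s0 = 1" and st: "s0 * t0 = 1" using t0 by (simp_all add: s0_def)
    obtain h1 where h1: "h1 \<in> carrier G" "\<And>v. act h1 v = v + ((t0 + 1) * B v f1) *s e1 + ((s0 + 1) * B v e1) *s f1"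
      using ex_hyperbolic[OF b(1) ts] by blast
    obtain h2 where h2: "h2 \<in> carrier G" "\<And>v. act h2 v = v + ((s0 + 1) * B v f2) *s e2 + ((t0 + 1) * B v e2) *s f2"
      using ex_hyperbolic[OF b(2) st] by blast
    define u where "u = h1 \<otimes> h2"
    have u: "u \<in> carrier G" using h1 h2 by (simp add: u_def)
    have ue: "act u e1 = t0 *s e1" "act u e2 = s0 *s e2" "act u f1 = s0 *s f1"
      using h1 h2 by (simp_all add: u_def act_mult b bilinear scale_left_distrib add.commute[of "_ *s _" e1]
         add.commute[of "_ *s _" e2] add.commute[of "_ *s _" f1])
    have uK: "u \<in> ?K" using u ue ts by (auto simp: plane_torus_group_def)
    have \<mu>u: "?\<mu> u = \<theta> t0" unfolding plane_char_eq[OF ue(1)] by (simp add: ue bilinear b)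
    have ge': "act g e1 = b' *s e2" "act g e2 = c *s e1" using ge sw by simp_all
    have "act g (c *s e1) = e2" "act g (b' *s e2) = e1"
      using g ge' sw(3) by (simp_all add: act_scale mult.commute)
    then have "act (inv g) e2 = c *s e1" "act (inv g) e1 = b' *s e2"
      using act_inv(1)[OF g] by metis+
    then have gue: "act (g \<otimes> u \<otimes> inv g) e1 = s0 *s e1" "act (g \<otimes> u \<otimes> inv g) e2 = t0 *s e2"
      using g u ue ge' sw(3) by (simp_all add: act_conj act_scale) (simp_all add: ac_simps)
    then have "g \<otimes> u \<otimes> inv g \<in> ?K" using g u st by (auto simp: plane_torus_group_def)
    moreover have "?\<mu> (g \<otimes> u \<otimes> inv g) \<noteq> \<theta> t0"
      unfolding plane_char_eq[OF gue(1)] by (rule \<theta>_t0_square_ne[OF ts])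
    ultimately show ?thesis using uK \<mu>u by (intro bexI[of _ u]) auto
  qed
  show ?P
  proof (rule ccontr)
    assume n: "\<not> ?P"
    have ab: "a * b' = 0" using transvection_case[of e1 a b'] ge b n by auto
    have cd: "c * d = 0" using transvection_case[of e2 c d] ge b n by auto
    have det: "a * d + b' * c = 1" using siegel_case n by blast
    show False
    proof (cases "a = 0")
      case True
      then have "b' * c = 1" using det by simp
      moreover from this have "d = 0" using cd by auto
      ultimately show False using swap_case True n by blast
    next
      case False
      then have b0: "b' = 0" using ab by simp
      then have ad: "a * d = 1" using det by simp
      then have "c = 0" using cd by auto
      then have "g \<in> ?K" using b0 ad ge g by (auto simp: plane_torus_group_def)
      then show False using gK by simp
    qed
  qed
qed

theorem not_strong_gelfand_pair_plane:
  "\<not> strong_gelfand_pair G (set_stabilizer {a *s e1 + c *s e2 | a c. True})"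
proof -
  let ?W = "{a *s e1 + c *s e2 | a c. True}"
  \<comment> \<open>On the torus of K the eigenvalues on f1 and f2 are s and t, so the flag
    character is \<open>\<theta> s * \<theta> t * \<theta> t = \<theta> t\<close>, as the plane
    character requires.\<close>
  let ?\<theta>2 = "\<lambda>x. \<theta> x * \<theta> x"
  have sb': "symplectic_basis f1 f2 e1 e2" by (rule symplectic_basis_swap[OF sb])
  have \<theta>2: "mult_character ?\<theta>2" using \<theta> by (auto simp: mult_character_def)
  interpret two_linear_characters G "plane_torus_group e1 e2" "plane_char e1 f1 f2"
      "flag_group f1 f2" "flag_char \<theta> ?\<theta>2 f1 f2 e1 e2"
    by (intro two_linear_characters.intro linear_character_plane linear_character_flag[OF sb' \<theta> \<theta>2])
  have "finite ?W"
  proof -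
    have "?W = (\<lambda>(a,c). a *s e1 + c *s e2) ` UNIV" by auto
    then show ?thesis by simp
  qed
  then have KH: "plane_torus_group e1 e2 \<subseteq> set_stabilizer ?W"
  proof (intro subsetI set_stabilizerI)
    fix k w assume "k \<in> plane_torus_group e1 e2" "w \<in> ?W"
    then obtain t s a c where "k \<in> carrier G" "act k e1 = t *s e1" "act k e2 = s *s e2" "w = a *s e1 + c *s e2"
      by (auto simp: plane_torus_group_def)
    then have "act k w = (a * t) *s e1 + (c * s) *s e2" by (simp add: act_add act_scale)
    then show "act k w \<in> ?W" by blast
  qed (auto simp: plane_torus_group_def)
  have \<theta>_neq: "\<theta> t0 * \<theta> t0 \<noteq> 1" "?\<theta>2 t0 * ?\<theta>2 t0 \<noteq> 1" "\<theta> t0 \<noteq> ?\<theta>2 t0" "\<theta> t0 * ?\<theta>2 t0 \<noteq> 1"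
  proof -
    show "\<theta> t0 * \<theta> t0 \<noteq> 1" "?\<theta>2 t0 * ?\<theta>2 t0 \<noteq> 1" "\<theta> t0 * ?\<theta>2 t0 \<noteq> 1"
      using \<theta>_t0 by (simp_all add: eval_nat_numeral ac_simps)
    have "\<theta> t0 \<noteq> 0" using \<theta>_inverse_pair[OF right_inverse[OF t0]] by auto
    then show "\<theta> t0 \<noteq> ?\<theta>2 t0" using \<theta>_t0(1) by auto
  qed
  have comp1: "compatible \<one>"
    unfolding compatible_def
  proof (intro ballI impI)
    fix k assume k: "k \<in> plane_torus_group e1 e2" and "\<one> \<otimes> k \<otimes> inv \<one> \<in> flag_group f1 f2"
    obtain t s p r p' r' where K: "k \<in> carrier G" "t * s = 1" "act k e1 = t *s e1" "act k e2 = s *s e2"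
      "act k f1 = s *s f1 + p *s e1 + r *s e2" "act k f2 = t *s f2 + p' *s e1 + r' *s e2"
      "plane_char e1 f1 f2 k = \<theta> t * \<phi> (t * r)" using plane_torus_groupE[OF k] .
    have k1: "\<one> \<otimes> k \<otimes> inv \<one> = k" using K(1) by simp
    then obtain c c' d where c: "act k f1 = c *s f1" "act k f2 = c' *s f2 + d *s f1"
      using \<open>\<one> \<otimes> k \<otimes> inv \<one> \<in> flag_group f1 f2\<close> by (auto simp: flag_group_def)
    have e: "s *s f1 + p *s e1 + r *s e2 = c *s f1" "t *s f2 + p' *s e1 + r' *s e2 = c' *s f2 + d *s f1"
      using c K(5,6) by simp_all
    have "s = c" using arg_cong[OF e(1), of "\<lambda>v. B v e1"] by (simp add: bilinear b)
    moreover have "r = 0" using arg_cong[OF e(1), of "\<lambda>v. B v f2"] by (simp add: bilinear b)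
    moreover have "t = c'" using arg_cong[OF e(2), of "\<lambda>v. B v e2"] by (simp add: bilinear b)
    ultimately show "flag_char \<theta> ?\<theta>2 f1 f2 e1 e2 (\<one> \<otimes> k \<otimes> inv \<one>) = plane_char e1 f1 f2 k"
      unfolding k1 flag_char_eq[OF sb' c] K(7) using \<theta>_inverse_pair[OF K(2)] by (simp add: mult.assoc[symmetric])
  qed
  \<comment> \<open>Pulled back by y, the flag keeps the plane of f1 and f2 but its line becomes
    that of f1 + f2. A torus element of K scales f1 and f2 by s and t, so preserving this line
    forces t = s.\<close>
  obtain y where y: "y \<in> carrier G" "\<And>v. act y v = v + 1 *s (B v f2 *s e1 + B v e1 *s f2)"
    using ex_siegel[OF b(10)] by blast
  have yf: "act y (f1 + f2) = f1" "act y f2 = f2" using y(2)[of "f1 + f2"] y(2)[of f2] by (simp_all add: bilinear b add.assoc)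
  then have yi: "act (inv y) f1 = f1 + f2" "act (inv y) f2 = f2" using act_inv(1)[OF y(1)] by metis+
  have comp2: "compatible y"
    unfolding compatible_def
  proof (intro ballI impI)
    fix k assume k: "k \<in> plane_torus_group e1 e2" and m: "y \<otimes> k \<otimes> inv y \<in> flag_group f1 f2"
    obtain t s p r p' r' where K: "k \<in> carrier G" "t * s = 1" "act k e1 = t *s e1" "act k e2 = s *s e2"
      "act k f1 = s *s f1 + p *s e1 + r *s e2" "act k f2 = t *s f2 + p' *s e1 + r' *s e2"
      "plane_char e1 f1 f2 k = \<theta> t * \<phi> (t * r)" using plane_torus_groupE[OF k] .
    obtain c c' d where c: "act y (act k (f1 + f2)) = c *s f1" "act y (act k f2) = c' *s f2 + d *s f1"
      using m K(1) y(1) yi by (auto simp: flag_group_def act_conj)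
    have "act y (act k (f1 + f2)) = act y (c *s (f1 + f2))" "act y (act k f2) = act y (c' *s f2 + d *s (f1 + f2))"
      using c y(1) yf by (simp_all add: act_scale act_add del: scale_right_distrib)
    then have e: "act k (f1 + f2) = c *s (f1 + f2)" "act k f2 = c' *s f2 + d *s (f1 + f2)"
      using y(1) by (simp_all only: act_inject)
    have e': "s *s f1 + p *s e1 + r *s e2 + (t *s f2 + p' *s e1 + r' *s e2) = c *s (f1 + f2)"
      "t *s f2 + p' *s e1 + r' *s e2 = c' *s f2 + d *s (f1 + f2)"
      using e K(1,5,6) by (simp_all add: act_add)
    have sc: "s = c" using arg_cong[OF e'(1), of "\<lambda>v. B v e1"] by (simp add: bilinear b)
    have tc: "t = c" using arg_cong[OF e'(1), of "\<lambda>v. B v e2"] by (simp add: bilinear b)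
    have c1: "c = 1" using K(2) unfolding sc tc by (rule square_eq_one)
    then have t1: "t = 1" "c = 1" unfolding tc by simp_all
    have r': "r' = 0" using arg_cong[OF e'(2), of "\<lambda>v. B v f2"] by (simp add: bilinear b)
    have p': "p' = 0" using arg_cong[OF e'(2), of "\<lambda>v. B v f1"] by (simp add: bilinear b)
    have r: "r = 0" using arg_cong[OF e'(1), of "\<lambda>v. B v f2"] r' by (simp add: bilinear b)
    have m1: "act (y \<otimes> k \<otimes> inv y) f1 = 1 *s f1" using c(1) K(1) y(1) yi t1 by (simp add: act_conj)
    have m2: "act (y \<otimes> k \<otimes> inv y) f2 = 1 *s f2 + 0 *s f1"
      using K(1,6) p' r' t1 y(1) yi yf by (simp add: act_conj)
    show "flag_char \<theta> ?\<theta>2 f1 f2 e1 e2 (y \<otimes> k \<otimes> inv y) = plane_char e1 f1 f2 k"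
      unfolding flag_char_eq[OF sb' m1 m2] K(7) r t1 by simp
  qed
  \<comment> \<open>As y sends f1 + f2 to f1, a factorisation of y makes k send f1 + f2 into the
    line of f1. The f2-component of that image is t, which is nonzero.\<close>
  have disj: "y \<notin> double_coset \<one>"
  proof
    assume "y \<in> double_coset \<one>"
    then obtain h k where hk: "h \<in> flag_group f1 f2" "k \<in> plane_torus_group e1 e2" "y = h \<otimes> \<one> \<otimes> k"
      by (auto simp: double_coset_def)
    obtain t s p r p' r' where K: "k \<in> carrier G" "t * s = 1" "act k e1 = t *s e1" "act k e2 = s *s e2"
      "act k f1 = s *s f1 + p *s e1 + r *s e2" "act k f2 = t *s f2 + p' *s e1 + r' *s e2"
      "plane_char e1 f1 f2 k = \<theta> t * \<phi> (t * r)" using plane_torus_groupE[OF hk(2)] .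
    obtain c c' d where h: "h \<in> carrier G" "act h f1 = c *s f1" "act h f2 = c' *s f2 + d *s f1"
      using hk(1) by (auto simp: flag_group_def)
    have c0: "c \<noteq> 0" by (rule flag_eigenvalues_nonzero[OF sb' h])
    have "act h (act k (f1 + f2)) = f1" using yf(1) hk(3) h(1) K(1) by (simp add: act_mult)
    then have "act h (act k (f1 + f2)) = act h (inverse c *s f1)" using h c0 by (simp add: act_scale)
    then have "act k (f1 + f2) = inverse c *s f1" using h(1) by (simp only: act_inject)
    then have "B (act k (f1 + f2)) e2 = 0" by (simp add: bilinear b)
    then have "t = 0" using K(1,5,6) by (simp add: act_add bilinear b)
    then show False using K(2) by simp
  qed
  show ?thesis
    by (rule not_strong_gelfand_pair[OF subgroup_set_stabilizer KH mackey_irreducible_plane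
          mackey_irreducible_flag[OF sb' \<theta> \<theta>2 t0 \<theta>_neq] one_closed y(1) comp1 comp2 disj])
qed

end

end

context char2_symplectic_chars
begin

section \<open>The stabilizer of a line\<close>

text \<open>The product $B(g f_1, f_2)\,B(g f_1, e_2)$ is a quadratic form on $\langle e_2, f_2\rangle$ polarising to
  \<open>B\<close>; adding it makes the central coordinate $B(g f_1, f_1)$ additive on the unipotent radical.\<close>

definition line_torus_group :: "'v \<Rightarrow> 'v \<Rightarrow> 'v \<Rightarrow> 'g set" where
  "line_torus_group e1 e2 f2 = {g \<in> carrier G. act g e1 = e1 \<and>
     (\<exists>t s a c. t * s = 1 \<and> act g e2 = t *s e2 + a *s e1 \<and> act g f2 = s *s f2 + c *s e1)}"

definition line_char :: "'v \<Rightarrow> 'v \<Rightarrow> 'v \<Rightarrow> 'g \<Rightarrow> complex" where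
  "line_char e2 f1 f2 g = \<theta> (B (act g e2) f2) * \<phi> (B (act g f1) f1 + B (act g f1) f2 * B (act g f1) e2)"

context
  fixes e1 e2 f1 f2 :: 'v
  assumes sb: "symplectic_basis e1 e2 f1 f2"
begin

private lemmas bl = symplectic_basis_B[OF sb]

text \<open>Invariance of B against f1 determines the e1-components of \<open>act k e2\<close> and
  \<open>act k f2\<close> from the coordinates x and y of \<open>act k f1\<close>.\<close>

lemma line_torus_groupE:
  assumes "k \<in> line_torus_group e1 e2 f2"
  obtains t s p x y where "k \<in> carrier G" "t * s = 1" "act k e1 = e1"
    "act k e2 = t *s e2 + (t * y) *s e1" "act k f2 = s *s f2 + (s * x) *s e1"
    "act k f1 = f1 + p *s e1 + x *s e2 + y *s f2"
    "line_char e2 f1 f2 k = \<theta> t * \<phi> (p + x * y)"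
proof -
  obtain t s a c where k: "k \<in> carrier G" "t * s = 1" "act k e1 = e1"
     "act k e2 = t *s e2 + a *s e1" "act k f2 = s *s f2 + c *s e1"
    using assms by (auto simp: line_torus_group_def)
  have f1e1: "B (act k f1) e1 = 1" using act_B[OF k(1), of f1 e1] k(3) bl by simp
  have "t * B (act k f1) e2 + a = 0"
    using act_B[OF k(1), of f1 e2] f1e1 bl unfolding k(4) by (simp add: bilinear)
  then have a: "a = t * B (act k f1) e2" by (subst eq_iff_add(1)) (simp add: add.commute)
  have "s * B (act k f1) f2 + c = 0"
    using act_B[OF k(1), of f1 f2] f1e1 bl unfolding k(5) by (simp add: bilinear)
  then have c: "c = s * B (act k f1) f2" by (subst eq_iff_add(1)) (simp add: add.commute)
  have e: "act k f1 = f1 + B (act k f1) f1 *s e1 + B (act k f1) f2 *s e2 + B (act k f1) e2 *s f2"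
    using expand[OF sb, of "act k f1"] f1e1 by (simp add: ac_simps)
  show thesis
    by (rule that[OF k(1-3) k(4)[unfolded a] k(5)[unfolded c] e])
      (simp add: line_char_def k(4) bilinear bl)
qed

lemma line_char_eq:
  assumes "act k e2 = t *s e2 + a *s e1"
  shows "line_char e2 f1 f2 k = \<theta> t * \<phi> (B (act k f1) f1 + B (act k f1) f2 * B (act k f1) e2)"
  by (simp add: line_char_def assms bilinear bl)

lemma linear_character_line: "linear_character G (line_torus_group e1 e2 f2) (line_char e2 f1 f2)"
proof -
  have mult: "g \<otimes> h \<in> line_torus_group e1 e2 f2 \<and>
      line_char e2 f1 f2 (g \<otimes> h) = line_char e2 f1 f2 g * line_char e2 f1 f2 h"
    if gh: "g \<in> line_torus_group e1 e2 f2" "h \<in> line_torus_group e1 e2 f2" for g h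
  proof -
    obtain t s p x y where g: "g \<in> carrier G" "t * s = 1" "act g e1 = e1"
      "act g e2 = t *s e2 + (t * y) *s e1" "act g f2 = s *s f2 + (s * x) *s e1"
      "act g f1 = f1 + p *s e1 + x *s e2 + y *s f2"
      "line_char e2 f1 f2 g = \<theta> t * \<phi> (p + x * y)" using line_torus_groupE[OF gh(1)] .
    obtain t' s' p' x' y' where h: "h \<in> carrier G" "t' * s' = 1" "act h e1 = e1"
      "act h e2 = t' *s e2 + (t' * y') *s e1" "act h f2 = s' *s f2 + (s' * x') *s e1"
      "act h f1 = f1 + p' *s e1 + x' *s e2 + y' *s f2"
      "line_char e2 f1 f2 h = \<theta> t' * \<phi> (p' + x' * y')" using line_torus_groupE[OF gh(2)] .
    have 1: "act (g \<otimes> h) e1 = e1" using g h by (simp add: act_mult)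
    have 2: "act (g \<otimes> h) e2 = (t * t') *s e2 + (t' * (t * y) + t' * y') *s e1"
      using g(1,3,4) h(1,4) by (simp add: act_mult act_add act_scale scale_right_distrib scale_left_distrib ac_simps)
    have 3: "act (g \<otimes> h) f2 = (s * s') *s f2 + (s' * (s * x) + s' * x') *s e1"
      using g(1,3,5) h(1,5) by (simp add: act_mult act_add act_scale scale_right_distrib scale_left_distrib ac_simps)
    have one: "(t * t') * (s * s') = 1"
    proof -
      have "(t * t') * (s * s') = (t * s) * (t' * s')" by (simp only: ac_simps)
      then show ?thesis using g(2) h(2) by simp
    qed
    have f1: "act (g \<otimes> h) f1 = act g f1 + p' *s act g e1 + x' *s act g e2 + y' *s act g f2"
      using g(1) h(1,6) by (simp add: act_mult act_add act_scale)
    have "B (act (g \<otimes> h) f1) f1 = p + p' + x' * (t * y) + y' * (s * x)"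
      "B (act (g \<otimes> h) f1) f2 = x + x' * t" "B (act (g \<otimes> h) f1) e2 = y + y' * s"
      unfolding f1 g(3-6) by (simp_all add: bilinear bl ac_simps)
    \<comment> \<open>The cocycle terms of the central coordinate cancel against the mixed terms of
      the product of the two other coordinates, as each occurs twice. The relation
      \<open>t * s = 1\<close> leaves the second product unscaled.\<close>
    moreover have "p + p' + x' * (t * y) + y' * (s * x) + (x + x' * t) * (y + y' * s)
       = (p + x * y) + (p' + (t * s) * (x' * y'))"
      by (simp add: distrib_left distrib_right ac_simps)
    ultimately have arg: "B (act (g \<otimes> h) f1) f1 + B (act (g \<otimes> h) f1) f2 * B (act (g \<otimes> h) f1) e2
       = (p + x * y) + (p' + x' * y')" using g(2) by simp
    have "t \<noteq> 0" "t' \<noteq> 0" using g(2) h(2) by auto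
    then have "line_char e2 f1 f2 (g \<otimes> h) = line_char e2 f1 f2 g * line_char e2 f1 f2 h"
      unfolding line_char_eq[OF 2] arg g(7) h(7) by (simp add: \<theta>_mult \<phi>_add[of "p + x * y"])
    moreover have "g \<otimes> h \<in> line_torus_group e1 e2 f2"
      using 1 2 3 one g(1) h(1) unfolding line_torus_group_def by blast
    ultimately show ?thesis by blast
  qed
  show ?thesis
  proof (rule linear_characterI)
    show "subgroup (line_torus_group e1 e2 f2) G"
      using mult by (intro subgroupI_finite)
        (auto simp: line_torus_group_def intro: exI[of _ 1] exI[of _ 0])
    show "line_char e2 f1 f2 \<one> = 1" by (simp add: line_char_def bl)
    show "line_char e2 f1 f2 (g \<otimes> h) = line_char e2 f1 f2 g * line_char e2 f1 f2 h"
      if "g \<in> line_torus_group e1 e2 f2" "h \<in> line_torus_group e1 e2 f2" for g h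
      using mult that by blast
  qed
qed

text \<open>Let g scale e1 by m and act on e2, f2 modulo e1 with coefficients a, b' and c, d.
  Transvections along e1 force m = 1, and Siegel elements force the split quadratic form to be
  preserved. Its isometries are diagonal, which puts g in K, or antidiagonal, in which case g
  inverts the torus and \<theta> detects it.\<close>

lemma mackey_irreducible_line:
  "mackey_irreducible G (set_stabilizer {a *s e1 | a. True}) (line_torus_group e1 e2 f2) (line_char e2 f1 f2)"
  unfolding mackey_irreducible_def
proof
  let ?K = "line_torus_group e1 e2 f2" and ?\<mu> = "line_char e2 f1 f2" and ?W = "{a *s e1 | a. True}"
  fix g assume gH: "g \<in> set_stabilizer ?W - ?K"
  then have g: "g \<in> carrier G" and gK: "g \<notin> ?K" and "act g ` ?W = ?W"
    unfolding set_stabilizer_def by blast+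
  moreover have "e1 = 1 *s e1" by simp
  then have "e1 \<in> ?W" by blast
  ultimately have "act g e1 \<in> ?W" by blast
  then obtain m where m: "act g e1 = m *s e1" by blast
  let ?P = "\<exists>u\<in>?K. g \<otimes> u \<otimes> inv g \<in> ?K \<and> ?\<mu> (g \<otimes> u \<otimes> inv g) \<noteq> ?\<mu> u"
  have KI: "k \<in> ?K" if "k \<in> carrier G" "act k e1 = e1" "act k e2 = 1 *s e2 + a *s e1" "act k f2 = 1 *s f2 + c *s e1" for k a c
    unfolding line_torus_group_def using that by (intro CollectI conjI exI[of _ 1] exI[of _ a] exI[of _ c]) auto
  have center_case: ?P if ne: "m * m \<noteq> 1"
  proof -
    obtain x where x: "\<phi> (x * (m * m)) \<noteq> \<phi> x" using \<phi>_separates[OF ne] by blast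
    obtain u where u: "u \<in> carrier G" "\<And>v. act u v = v + (x * B v e1) *s e1" using ex_transvection by blast
    have u1: "act u e1 = e1" "act u e2 = 1 *s e2 + 0 *s e1" "act u f2 = 1 *s f2 + 0 *s e1" using u bl by simp_all
    note gu = act_conj_transvection[OF g u, unfolded m]
    have u2: "act (g \<otimes> u \<otimes> inv g) e1 = e1" "act (g \<otimes> u \<otimes> inv g) e2 = 1 *s e2 + 0 *s e1"
       "act (g \<otimes> u \<otimes> inv g) f2 = 1 *s f2 + 0 *s e1"
      unfolding gu by (simp_all add: bilinear bl)
    have "?\<mu> u = \<phi> x" unfolding line_char_eq[OF u1(2)] by (simp add: u bilinear bl)
    moreover have "?\<mu> (g \<otimes> u \<otimes> inv g) = \<phi> (x * (m * m))"
      unfolding line_char_eq[OF u2(2)] gu by (simp add: bilinear bl mult.assoc)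
    ultimately show ?thesis using KI[OF u(1) u1] KI[OF _ u2] u g x by (intro bexI[of _ u]) auto
  qed
  show ?P
  proof (rule ccontr)
    assume n: "\<not> ?P"
    have "m = 1" using center_case n square_eq_one by blast
    then have ge1: "act g e1 = e1" using m by simp
    have orth: "B (act g e2) e1 = 0" "B (act g f2) e1 = 0"
      using act_B[OF g, of e2 e1] act_B[OF g, of f2 e1] ge1 bl by simp_all
    obtain a b' \<alpha> where ge2: "act g e2 = a *s e2 + b' *s f2 + \<alpha> *s e1"
      using expand[OF sb, of "act g e2"] orth by (metis add.assoc add.commute add.right_neutral scale_zero_left)
    obtain c d \<beta> where gf2: "act g f2 = c *s e2 + d *s f2 + \<beta> *s e1"
      using expand[OF sb, of "act g f2"] orth by (metis add.assoc add.commute add.right_neutral scale_zero_left)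
    have det: "a * d + b' * c = 1"
      using act_B[OF g, of e2 f2] unfolding ge2 gf2 by (simp add: bilinear bl ac_simps)
    have siegel_case: ?P
      if p: "B e1 p = 0" "B f1 p = 0" "B p f2 * B p e2 = 0" "act g p = \<gamma> *s e2 + \<delta> *s f2 + \<epsilon> *s e1" and ne: "\<gamma> * \<delta> \<noteq> 0"
      for p \<gamma> \<delta> \<epsilon>
    proof -
      obtain x' where x': "\<phi> (x' * (\<gamma> * \<delta>)) \<noteq> 1" using \<phi>_nontrivial[OF ne] by blast
      \<comment> \<open>The conjugate of the Siegel element with parameter x has character value
        \<open>\<phi> (x * x * (\<gamma> * \<delta>))\<close>, so the parameter is a square root of
        the wanted one.\<close>
      obtain x where x: "x * x = x'" using ex_square_root by blast
      obtain u where u: "u \<in> carrier G" "\<And>v. act u v = v + x *s (B v e1 *s p + B v p *s e1)"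
        using ex_siegel[OF p(1)] by blast
      have u1: "act u e1 = e1" "act u e2 = 1 *s e2 + (x * B e2 p) *s e1" "act u f2 = 1 *s f2 + (x * B f2 p) *s e1"
        using u p bl by simp_all
      note gu = act_conj_siegel[OF g u, unfolded ge1 p(4)]
      have u2: "act (g \<otimes> u \<otimes> inv g) e1 = e1" "act (g \<otimes> u \<otimes> inv g) e2 = 1 *s e2 + (x * \<delta>) *s e1"
         "act (g \<otimes> u \<otimes> inv g) f2 = 1 *s f2 + (x * \<gamma>) *s e1"
        unfolding gu by (simp_all add: bilinear bl)
      have "act u f1 = f1 + x *s p" using u p bl by simp
      then have "?\<mu> u = 1" unfolding line_char_eq[OF u1(2)]
        using p B_sym[of p f1] by (auto simp: bilinear bl)
      moreover have "act (g \<otimes> u \<otimes> inv g) f1 = f1 + x *s (\<gamma> *s e2 + \<delta> *s f2)"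
        unfolding gu by (simp add: bilinear bl add.assoc)
      then have "?\<mu> (g \<otimes> u \<otimes> inv g) = \<phi> (x' * (\<gamma> * \<delta>))"
        unfolding line_char_eq[OF u2(2)] x[symmetric] by (simp add: bilinear bl ac_simps)
      ultimately show ?thesis using KI[OF u(1) u1] KI[OF _ u2] u g x' by (intro bexI[of _ u]) auto
    qed
    have ab: "a * b' = 0" using siegel_case[OF _ _ _ ge2] bl n by auto
    have cd: "c * d = 0" using siegel_case[OF _ _ _ gf2] bl n by auto
    show False
    proof (cases "a = 0")
      case False
      then have b0: "b' = 0" using ab by simp
      then have ad: "a * d = 1" using det by simp
      then have "c = 0" using cd by auto
      then have "act g e2 = a *s e2 + \<alpha> *s e1" "act g f2 = d *s f2 + \<beta> *s e1" using b0 ge2 gf2 by simp_all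
      then have "g \<in> ?K" using ad ge1 g unfolding line_torus_group_def by blast
      then show False using gK by simp
    next
      case a0: True
      then have bc: "b' * c = 1" using det by simp
      then have d0: "d = 0" using cd by auto
      define s0 where "s0 = inverse t0"
      have ts: "t0 * s0 = 1" and st: "s0 * t0 = 1" using t0 by (simp_all add: s0_def)
      obtain u where u: "u \<in> carrier G" "\<And>v. act u v = v + ((t0 + 1) * B v f2) *s e2 + ((s0 + 1) * B v e2) *s f2"
        using ex_hyperbolic[OF bl(2) ts] by blast
      have ue: "act u e1 = e1" "act u e2 = t0 *s e2 + 0 *s e1" "act u f2 = s0 *s f2 + 0 *s e1" "act u f1 = f1"
        using u by (simp_all add: bl scale_left_distrib add.commute[of "_ *s _" e2] add.commute[of "_ *s _" f2])
      have uK: "u \<in> ?K" using u(1) ue ts unfolding line_torus_group_def by blast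
      have \<mu>u: "?\<mu> u = \<theta> t0" unfolding line_char_eq[OF ue(2)] by (simp add: ue bl)
      let ?k = "g \<otimes> u \<otimes> inv g"
      have k: "?k \<in> carrier G" using g u by simp
      have inv_e1: "act (inv g) e1 = e1" using act_inv(1)[OF g, of e1] ge1 by simp
      have ke1: "act ?k e1 = e1" using act_conj[OF g u(1), of e1] unfolding inv_e1 ue(1) ge1 .
      \<comment> \<open>Evaluating the conjugate on images under g avoids a formula for
        \<open>inv g\<close> on e2 and f2; its action on these is then solved for from
        \<open>ge\<close>.\<close>
      have kg: "act ?k (act g v) = act g (act u v)" for v using g u(1) by (simp add: act_conj)
      have ge: "act g e2 = b' *s f2 + \<alpha> *s e1" "act g f2 = c *s e2 + \<beta> *s e1" using ge2 gf2 a0 d0 by simp_all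
      have "b' *s act ?k f2 + \<alpha> *s e1 = t0 *s (b' *s f2 + \<alpha> *s e1)"
        using kg[of e2] k ke1 g ue(2) ge(1) by (simp add: act_add act_scale)
      then have "b' *s act ?k f2 = (t0 * b') *s f2 + (t0 * \<alpha> + \<alpha>) *s e1"
        by (subst (asm) eq_iff_add(2), subst eq_iff_add(2)) (simp add: scale_right_distrib scale_left_distrib ac_simps)
      then have "c *s (b' *s act ?k f2) = c *s ((t0 * b') *s f2 + (t0 * \<alpha> + \<alpha>) *s e1)" by simp
      then have kf2: "act ?k f2 = t0 *s f2 + (c * (t0 * \<alpha> + \<alpha>)) *s e1"
        using bc by (simp add: scale_right_distrib mult.commute[of c b'] mult.left_commute[of c t0 b'])
      have "c *s act ?k e2 + \<beta> *s e1 = s0 *s (c *s e2 + \<beta> *s e1)"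
        using kg[of f2] k ke1 g ue(3) ge(2) by (simp add: act_add act_scale)
      then have "c *s act ?k e2 = (s0 * c) *s e2 + (s0 * \<beta> + \<beta>) *s e1"
        by (subst (asm) eq_iff_add(2), subst eq_iff_add(2)) (simp add: scale_right_distrib scale_left_distrib ac_simps)
      then have "b' *s (c *s act ?k e2) = b' *s ((s0 * c) *s e2 + (s0 * \<beta> + \<beta>) *s e1)" by simp
      then have ke2: "act ?k e2 = s0 *s e2 + (b' * (s0 * \<beta> + \<beta>)) *s e1"
        using bc by (simp add: scale_right_distrib mult.left_commute[of b' s0 c])
      have "?k \<in> ?K" using k ke1 ke2 kf2 st unfolding line_torus_group_def by blast
      moreover have "?\<mu> ?k \<noteq> \<theta> t0"
        unfolding line_char_eq[OF ke2] by (rule \<theta>_t0_square_ne[OF ts])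
      ultimately show False using n uK \<mu>u by auto
    qed
  qed
qed

theorem not_strong_gelfand_pair_line:
  "\<not> strong_gelfand_pair G (set_stabilizer {a *s e1 | a. True})"
proof -
  let ?W = "{a *s e1 | a. True}"
  \<comment> \<open>The torus of K fixes f1 and scales e2 by t, so the second component must be
    \<theta>, while the first is seen only at 1 and is chosen as the square for regularity.\<close>
  let ?\<theta>2 = "\<lambda>x. \<theta> x * \<theta> x"
  have sb': "symplectic_basis f1 e2 e1 f2" by (rule symplectic_basis_swap[OF sb])
  have \<theta>2: "mult_character ?\<theta>2" using \<theta> by (auto simp: mult_character_def)
  interpret two_linear_characters G "line_torus_group e1 e2 f2" "line_char e2 f1 f2"
      "flag_group f1 e2" "flag_char ?\<theta>2 \<theta> f1 e2 e1 f2"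
    by (intro two_linear_characters.intro linear_character_line linear_character_flag[OF sb' \<theta>2 \<theta>])
  have "finite ?W"
  proof -
    have "?W = (\<lambda>a. a *s e1) ` UNIV" by auto
    then show ?thesis by simp
  qed
  then have KH: "line_torus_group e1 e2 f2 \<subseteq> set_stabilizer ?W"
  proof (intro subsetI set_stabilizerI)
    fix k w assume "k \<in> line_torus_group e1 e2 f2" "w \<in> ?W"
    then show "act k w \<in> ?W" by (auto simp: line_torus_group_def act_scale)
  qed (auto simp: line_torus_group_def)
  have \<theta>_neq: "?\<theta>2 t0 * ?\<theta>2 t0 \<noteq> 1" "\<theta> t0 * \<theta> t0 \<noteq> 1" "?\<theta>2 t0 \<noteq> \<theta> t0" "?\<theta>2 t0 * \<theta> t0 \<noteq> 1"
  proof -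
    show "\<theta> t0 * \<theta> t0 \<noteq> 1" "?\<theta>2 t0 * ?\<theta>2 t0 \<noteq> 1" "?\<theta>2 t0 * \<theta> t0 \<noteq> 1"
      using \<theta>_t0 by (simp_all add: eval_nat_numeral ac_simps)
    have "\<theta> t0 \<noteq> 0" using \<theta>_inverse_pair[OF right_inverse[OF t0]] by auto
    then show "?\<theta>2 t0 \<noteq> \<theta> t0" using \<theta>_t0(1) by auto
  qed
  have comp1: "compatible \<one>"
    unfolding compatible_def
  proof (intro ballI impI)
    fix k assume k: "k \<in> line_torus_group e1 e2 f2" and m: "\<one> \<otimes> k \<otimes> inv \<one> \<in> flag_group f1 e2"
    obtain t s p x y where K: "k \<in> carrier G" "t * s = 1" "act k e1 = e1"
      "act k e2 = t *s e2 + (t * y) *s e1" "act k f2 = s *s f2 + (s * x) *s e1"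
      "act k f1 = f1 + p *s e1 + x *s e2 + y *s f2"
      "line_char e2 f1 f2 k = \<theta> t * \<phi> (p + x * y)" using line_torus_groupE[OF k] .
    have k1: "\<one> \<otimes> k \<otimes> inv \<one> = k" using K(1) by simp
    then obtain c c' d where c: "act k f1 = c *s f1" "act k e2 = c' *s e2 + d *s f1"
      using m by (auto simp: flag_group_def)
    note e = K(6)[unfolded c(1)] K(4)[unfolded c(2)]
    have "c = 1" using arg_cong[OF e(1), of "\<lambda>v. B v e1"] by (simp add: bilinear bl)
    moreover have "p = 0" using arg_cong[OF e(1), of "\<lambda>v. B v f1"] by (simp add: bilinear bl)
    moreover have "x = 0" using arg_cong[OF e(1), of "\<lambda>v. B v f2"] by (simp add: bilinear bl)
    moreover have "c' = t" using arg_cong[OF e(2), of "\<lambda>v. B v f2"] by (simp add: bilinear bl)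
    ultimately show "flag_char ?\<theta>2 \<theta> f1 e2 e1 f2 (\<one> \<otimes> k \<otimes> inv \<one>) = line_char e2 f1 f2 k"
      unfolding k1 flag_char_eq[OF sb' c] K(7) by simp
  qed
  \<comment> \<open>Pulled back by y, the flag keeps the line of f1 but e2 is replaced by e2 + f2. A
    torus element of K scales e2 and f2 by t and s, so preserving the plane forces t = s.\<close>
  obtain y where y: "y \<in> carrier G" "\<And>v. act y v = v + (1 * B v f2) *s f2"
    using ex_transvection by blast
  have yf: "act y f1 = f1" "act y (e2 + f2) = e2" using y(2)[of "e2 + f2"] y(2)[of f1] by (simp_all add: bilinear bl add.assoc)
  then have yi: "act (inv y) f1 = f1" "act (inv y) e2 = e2 + f2" using act_inv(1)[OF y(1)] by metis+
  have comp2: "compatible y"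
    unfolding compatible_def
  proof (intro ballI impI)
    fix k assume k: "k \<in> line_torus_group e1 e2 f2" and m: "y \<otimes> k \<otimes> inv y \<in> flag_group f1 e2"
    obtain t s p x z where K: "k \<in> carrier G" "t * s = 1" "act k e1 = e1"
      "act k e2 = t *s e2 + (t * z) *s e1" "act k f2 = s *s f2 + (s * x) *s e1"
      "act k f1 = f1 + p *s e1 + x *s e2 + z *s f2"
      "line_char e2 f1 f2 k = \<theta> t * \<phi> (p + x * z)" using line_torus_groupE[OF k] .
    obtain c c' d where c: "act y (act k f1) = c *s f1" "act y (act k (e2 + f2)) = c' *s e2 + d *s f1"
      using m K(1) y(1) yi by (auto simp: flag_group_def act_conj)
    have "act y (act k f1) = act y (c *s f1)" "act y (act k (e2 + f2)) = act y (c' *s (e2 + f2) + d *s f1)"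
      using c y(1) yf by (simp_all add: act_scale act_add del: scale_right_distrib)
    then have e: "act k f1 = c *s f1" "act k (e2 + f2) = c' *s (e2 + f2) + d *s f1"
      using y(1) by (simp_all only: act_inject)
    note e1 = K(6)[unfolded e(1)]
    have c1: "c = 1" using arg_cong[OF e1, of "\<lambda>v. B v e1"] by (simp add: bilinear bl)
    have p: "p = 0" using arg_cong[OF e1, of "\<lambda>v. B v f1"] by (simp add: bilinear bl)
    have x: "x = 0" using arg_cong[OF e1, of "\<lambda>v. B v f2"] by (simp add: bilinear bl)
    have z: "z = 0" using arg_cong[OF e1, of "\<lambda>v. B v e2"] by (simp add: bilinear bl)
    have e2: "t *s e2 + s *s f2 = c' *s (e2 + f2) + d *s f1"
      using e(2) K(1,4,5) x z by (simp add: act_add)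
    have tc: "t = c'" using arg_cong[OF e2, of "\<lambda>v. B v f2"] by (simp add: bilinear bl)
    have sc: "s = c'" using arg_cong[OF e2, of "\<lambda>v. B v e2"] by (simp add: bilinear bl)
    have c': "c' = 1" using K(2) unfolding sc tc by (rule square_eq_one)
    have m1: "act (y \<otimes> k \<otimes> inv y) f1 = 1 *s f1" using c(1) K(1) y(1) yi c1 by (simp add: act_conj)
    have "act k (e2 + f2) = e2 + f2" using K(1,4,5) x z tc sc c' by (simp add: act_add)
    then have m2: "act (y \<otimes> k \<otimes> inv y) e2 = 1 *s e2 + 0 *s f1"
      using K(1) y(1) yi yf by (simp add: act_conj)
    show "flag_char ?\<theta>2 \<theta> f1 e2 e1 f2 (y \<otimes> k \<otimes> inv y) = line_char e2 f1 f2 k"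
      unfolding flag_char_eq[OF sb' m1 m2] K(7) p x tc c' by simp
  qed
  \<comment> \<open>In a factorisation of y the element \<open>h \<otimes> k\<close> sends e2 + f2
    to e2, and \<open>act h e2\<close> is orthogonal to e2. Invariance of B under h then makes
    \<open>act k (e2 + f2)\<close> orthogonal to e2, although its f2-component is s, which is
    nonzero.\<close>
  have disj: "y \<notin> double_coset \<one>"
  proof
    assume "y \<in> double_coset \<one>"
    then obtain h k where hk: "h \<in> flag_group f1 e2" "k \<in> line_torus_group e1 e2 f2" "y = h \<otimes> \<one> \<otimes> k"
      by (auto simp: double_coset_def)
    obtain t s p x z where K: "k \<in> carrier G" "t * s = 1" "act k e1 = e1"
      "act k e2 = t *s e2 + (t * z) *s e1" "act k f2 = s *s f2 + (s * x) *s e1"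
      "act k f1 = f1 + p *s e1 + x *s e2 + z *s f2"
      "line_char e2 f1 f2 k = \<theta> t * \<phi> (p + x * z)" using line_torus_groupE[OF hk(2)] .
    obtain c c' d where h: "h \<in> carrier G" "act h f1 = c *s f1" "act h e2 = c' *s e2 + d *s f1"
      using hk(1) by (auto simp: flag_group_def)
    have "act h (act k (e2 + f2)) = e2" using yf(2) hk(3) h(1) K(1) by (simp add: act_mult)
    then have "B (act k (e2 + f2)) e2 = B e2 (act h e2)" using act_B[OF h(1), of "act k (e2 + f2)" e2] by simp
    then have "s = 0" using K(1,4,5) h(3) by (simp add: act_add bilinear bl)
    then show False using K(2) by simp
  qed
  show ?thesis
    by (rule not_strong_gelfand_pair[OF subgroup_set_stabilizer KH mackey_irreducible_line
          mackey_irreducible_flag[OF sb' \<theta>2 \<theta> t0 \<theta>_neq] one_closed y(1) comp1 comp2 disj])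
qed

end

end

section \<open>The concrete symplectic group\<close>

text \<open>The locale wants the vector space to be a whole type with addition. Quadruples provide
  it, whereas \<open>carrier_vec 4\<close> is only a subset of the vectors of all
  dimensions.\<close>

type_synonym 'a quad = "'a \<times> 'a \<times> 'a \<times> 'a"

definition to_vec :: "'a quad \<Rightarrow> 'a vec" where
  "to_vec = (\<lambda>(a,b,c,d). vec 4 (\<lambda>i. if i = 0 then a else if i = 1 then b else if i = 2 then c else d))"

definition of_vec :: "'a vec \<Rightarrow> 'a quad" where
  "of_vec v = (v $ 0, v $ 1, v $ 2, v $ 3)"

definition quad_scale :: "'a::times \<Rightarrow> 'a quad \<Rightarrow> 'a quad" where
  "quad_scale k = (\<lambda>(a,b,c,d). (k * a, k * b, k * c, k * d))"

definition quad_form :: "'a::field quad \<Rightarrow> 'a quad \<Rightarrow> 'a" where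
  "quad_form x y = sform (to_vec x) (to_vec y)"

definition quad_act :: "'a::field mat \<Rightarrow> 'a quad \<Rightarrow> 'a quad" where
  "quad_act A x = of_vec (A *\<^sub>v to_vec x)"

lemma less_4_cases: "(i::nat) < 4 \<longleftrightarrow> i = 0 \<or> i = 1 \<or> i = 2 \<or> i = 3" by arith

lemma dim_to_vec [simp]: "dim_vec (to_vec x) = 4"
  by (cases x) (simp add: to_vec_def)

lemma to_vec_carrier [simp]: "to_vec x \<in> carrier_vec 4"
  by (rule carrier_vecI) (rule dim_to_vec)

lemma of_vec_to_vec [simp]: "of_vec (to_vec x) = x"
  by (cases x) (simp add: to_vec_def of_vec_def)

lemma to_vec_of_vec [simp]: "v \<in> carrier_vec 4 \<Longrightarrow> to_vec (of_vec v) = v"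
  by (intro eq_vecI) (auto simp: to_vec_def of_vec_def less_4_cases)

lemma of_vec_add: "u \<in> carrier_vec 4 \<Longrightarrow> v \<in> carrier_vec 4 \<Longrightarrow> of_vec (u + v) = of_vec u + of_vec v"
  by (simp add: of_vec_def)

lemma of_vec_smult: "v \<in> carrier_vec 4 \<Longrightarrow> of_vec (k \<cdot>\<^sub>v v) = quad_scale k (of_vec v)"
  by (simp add: of_vec_def quad_scale_def)

lemma to_vec_add: "to_vec (x + y) = to_vec x + to_vec y"
proof -
  have "of_vec (to_vec x + to_vec y) = x + y" by (simp add: of_vec_add)
  then show ?thesis using to_vec_of_vec[of "to_vec x + to_vec y"] by simp
qed

lemma to_vec_scale: "to_vec (quad_scale k x) = k \<cdot>\<^sub>v to_vec x"
proof -
  have "of_vec (k \<cdot>\<^sub>v to_vec x) = quad_scale k x" by (simp add: of_vec_smult)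
  then show ?thesis using to_vec_of_vec[of "k \<cdot>\<^sub>v to_vec x"] by simp
qed

lemma J4_carrier [simp]: "J4 \<in> carrier_mat 4 4" by (simp add: J4_def)

lemma quad_form_eq:
  "quad_form (a,b,c,d) (a',b',c',d') = a * c' + b * d' - c * a' - d * b'"
  by (simp add: quad_form_def sform_def J4_def to_vec_def scalar_prod_def eval_nat_numeral)

lemma sform_act:
  assumes A: "A \<in> carrier_mat 4 4" and x: "x \<in> carrier_vec 4" "y \<in> carrier_vec 4"
  shows "sform (A *\<^sub>v x) (A *\<^sub>v y) = x \<bullet> ((transpose_mat A * J4 * A) *\<^sub>v y)"
proof -
  let ?z = "J4 *\<^sub>v (A *\<^sub>v y)"
  have z: "?z \<in> carrier_vec 4" using A x by (meson J4_carrier mult_mat_vec_carrier)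
  have Ax: "A *\<^sub>v x \<in> carrier_vec 4" using A x by (meson mult_mat_vec_carrier)
  have "sform (A *\<^sub>v x) (A *\<^sub>v y) = ?z \<bullet> (A *\<^sub>v x)"
    unfolding sform_def by (rule comm_scalar_prod[OF Ax z])
  also have "\<dots> = (transpose_mat A *\<^sub>v ?z) \<bullet> x"
    by (rule transpose_vec_mult_scalar[symmetric, OF A x(1) z])
  also have "\<dots> = x \<bullet> (transpose_mat A *\<^sub>v ?z)"
    using A z x by (intro comm_scalar_prod[of _ 4]) auto
  also have "transpose_mat A *\<^sub>v ?z = (transpose_mat A * J4 * A) *\<^sub>v y"
    using A x assoc_mult_mat_vec[of "transpose_mat A" 4 4 J4 4 "A *\<^sub>v y"]
      assoc_mult_mat_vec[of "transpose_mat A * J4" 4 4 A 4 y] by (simp add: mult_mat_vec_carrier[of A 4 4])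
  finally show ?thesis .
qed

lemma mat_eqI_units:
  assumes M: "M \<in> carrier_mat n n" and N: "N \<in> carrier_mat n n"
    and "\<And>i j. i < n \<Longrightarrow> j < n \<Longrightarrow> unit_vec n i \<bullet> (M *\<^sub>v unit_vec n j) = unit_vec n i \<bullet> (N *\<^sub>v unit_vec n j)"
  shows "M = (N :: 'a::comm_ring_1 mat)"
proof (rule eq_matI)
  fix i j assume ij: "i < dim_row N" "j < dim_col N"
  have "unit_vec n i \<bullet> (P *\<^sub>v unit_vec n j) = P $$ (i,j)" if "P \<in> carrier_mat n n" for P :: "'a mat"
  proof -
    have "P *\<^sub>v unit_vec n j \<in> carrier_vec n" using that by (meson mult_mat_vec_carrier unit_vec_carrier)
    then show ?thesis using that ij N by simp
  qed
  then show "M $$ (i,j) = N $$ (i,j)" using assms ij by auto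
qed (use M N in auto)

lemma Sp4_iff:
  assumes A: "A \<in> carrier_mat 4 4"
  shows "A \<in> carrier Sp4 \<longleftrightarrow> (\<forall>x y. quad_form (quad_act A x) (quad_act A y) = quad_form x y)"
proof
  have Ac: "A *\<^sub>v to_vec x \<in> carrier_vec 4" for x using A by (meson mult_mat_vec_carrier to_vec_carrier)
  have e: "quad_form (quad_act A x) (quad_act A y) = to_vec x \<bullet> ((transpose_mat A * J4 * A) *\<^sub>v to_vec y)" for x y
    using Ac by (simp add: quad_form_def quad_act_def sform_act[OF A])
  { assume "A \<in> carrier Sp4"
    then show "\<forall>x y. quad_form (quad_act A x) (quad_act A y) = quad_form x y"
      unfolding e by (simp add: Sp4_def quad_form_def sform_def) }
  { assume h: "\<forall>x y. quad_form (quad_act A x) (quad_act A y) = quad_form x y"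
    have xy: "x \<bullet> ((transpose_mat A * J4 * A) *\<^sub>v y) = x \<bullet> (J4 *\<^sub>v y)"
      if "x \<in> carrier_vec 4" "y \<in> carrier_vec 4" for x y
      using h[rule_format, of "of_vec x" "of_vec y"] unfolding e
      by (simp only: quad_form_def sform_def to_vec_of_vec[OF that(1)] to_vec_of_vec[OF that(2)])
    have At: "transpose_mat A \<in> carrier_mat 4 4" using A by simp
    have "transpose_mat A * J4 * A = J4"
      by (rule mat_eqI_units[OF mult_carrier_mat[OF mult_carrier_mat[OF At J4_carrier] A] J4_carrier])
        (rule xy[OF unit_vec_carrier unit_vec_carrier])
    then show "A \<in> carrier Sp4" using A by (simp add: Sp4_def) }
qed

lemma finite_carrier_mat: "finite (carrier_mat m n :: 'a::finite mat set)"
proof (rule finite_imageD)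
  let ?f = "\<lambda>A :: 'a mat. \<lambda>p \<in> {..<m} \<times> {..<n}. A $$ p"
  have "?f ` carrier_mat m n \<subseteq> ({..<m} \<times> {..<n}) \<rightarrow>\<^sub>E UNIV"
    by (intro image_subsetI restrict_PiE_iff[THEN iffD2]) simp
  then show "finite (?f ` carrier_mat m n)" by (rule finite_subset) (simp add: finite_PiE)
  show "inj_on ?f (carrier_mat m n)"
  proof (rule inj_onI)
    fix A C :: "'a mat" assume AC: "A \<in> carrier_mat m n" "C \<in> carrier_mat m n" and e: "?f A = ?f C"
    show "A = C"
    proof (rule eq_matI)
      fix i j assume "i < dim_row C" "j < dim_col C"
      then have "(i,j) \<in> {..<m} \<times> {..<n}" using AC by auto
      then show "A $$ (i,j) = C $$ (i,j)" using fun_cong[OF e, of "(i,j)"] by simp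
    qed (use AC in auto)
  qed
qed

lemma quad_act_mult:
  assumes "A \<in> carrier_mat 4 4" "C \<in> carrier_mat 4 4"
  shows "quad_act (A * C) x = quad_act A (quad_act C x)"
  using assms mult_mat_vec_carrier[OF assms(2) to_vec_carrier]
  by (simp add: quad_act_def assoc_mult_mat_vec[of _ 4 4 _ 4])

lemma quad_act_one: "quad_act (1\<^sub>m 4) x = x"
  by (simp add: quad_act_def)

lemma uminus_J4_mult_J4: "- J4 * J4 = (1\<^sub>m 4 :: 'a::field mat)"
  by (intro eq_matI) (auto simp: J4_def scalar_prod_def less_4_cases eval_nat_numeral)

lemma group_Sp4: "group (Sp4 :: 'a::field mat monoid)"
proof (rule groupI)
  show "\<one>\<^bsub>Sp4\<^esub> \<in> carrier (Sp4 :: 'a mat monoid)"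
    by (simp add: Sp4_def left_mult_one_mat[OF J4_carrier] right_mult_one_mat[OF J4_carrier])
  fix A C :: "'a mat" assume A: "A \<in> carrier Sp4"
  then have Ac: "A \<in> carrier_mat 4 4" and AJ: "transpose_mat A * J4 * A = J4" by (auto simp: Sp4_def)
  { assume C: "C \<in> carrier Sp4"
    then have Cc: "C \<in> carrier_mat 4 4" by (simp add: Sp4_def)
    have "\<forall>x y. quad_form (quad_act (A * C) x) (quad_act (A * C) y) = quad_form x y"
      using Sp4_iff[OF Ac] Sp4_iff[OF Cc] A C unfolding quad_act_mult[OF Ac Cc] by metis
    then have "A * C \<in> carrier Sp4" using Sp4_iff[OF mult_carrier_mat[OF Ac Cc]] by blast
    then show "A \<otimes>\<^bsub>Sp4\<^esub> C \<in> carrier Sp4" by (simp add: Sp4_def) }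
  show "\<one>\<^bsub>Sp4\<^esub> \<otimes>\<^bsub>Sp4\<^esub> A = A" using Ac by (simp add: Sp4_def)
  show "\<exists>D\<in>carrier Sp4. D \<otimes>\<^bsub>Sp4\<^esub> A = \<one>\<^bsub>Sp4\<^esub>"
  proof (intro bexI)
    \<comment> \<open>Solving the defining equation for the inverse of A, with \<open>- J4\<close>
      as the inverse of J4.\<close>
    let ?D = "- J4 * (transpose_mat A * J4)"
    have Dc: "?D \<in> carrier_mat 4 4" 
      by (intro mult_carrier_mat[of _ 4 4]) (use Ac in auto)
    have "?D * A = - J4 * (transpose_mat A * J4 * A)"
      by (rule assoc_mult_mat[of _ 4 4 _ 4 _ 4]) (use Ac in \<open>auto intro: mult_carrier_mat[of _ 4 4]\<close>)
    then have DA: "?D * A = 1\<^sub>m 4" by (simp only: AJ uminus_J4_mult_J4)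
    then show "?D \<otimes>\<^bsub>Sp4\<^esub> A = \<one>\<^bsub>Sp4\<^esub>" by (simp add: Sp4_def)
    have AD: "A * ?D = 1\<^sub>m 4" by (rule mat_mult_left_right_inverse[OF Dc Ac DA])
    have "quad_form (quad_act ?D x) (quad_act ?D y) = quad_form x y" for x y
      using A Sp4_iff[OF Ac] quad_act_mult[OF Ac Dc] quad_act_one unfolding AD by metis
    then show "?D \<in> carrier Sp4" using Sp4_iff[OF Dc] by blast
  qed
next
  fix A C D :: "'a mat" assume "A \<in> carrier Sp4" "C \<in> carrier Sp4" "D \<in> carrier Sp4"
  then show "A \<otimes>\<^bsub>Sp4\<^esub> C \<otimes>\<^bsub>Sp4\<^esub> D = A \<otimes>\<^bsub>Sp4\<^esub> (C \<otimes>\<^bsub>Sp4\<^esub> D)"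
    by (simp add: Sp4_def assoc_mult_mat[of _ 4 4 _ 4 _ 4])
qed

definition std_mat :: "('a::field quad \<Rightarrow> 'a quad) \<Rightarrow> 'a mat" where
  "std_mat f = mat 4 4 (\<lambda>(i,j). to_vec (f (of_vec (unit_vec 4 j))) $ i)"

lemma quad_act_std_mat:
  assumes add: "\<And>x y. f (x + y) = f x + f y" and scale: "\<And>c x. f (quad_scale c x) = quad_scale c (f x)"
  shows "quad_act (std_mat f) x = f x"
proof -
  let ?u = "\<lambda>j. of_vec (unit_vec 4 j)"
  obtain a b c d where x: "x = (a,b,c,d)" by (cases x)
  have x': "x = quad_scale a (?u 0) + quad_scale b (?u 1) + quad_scale c (?u 2) + quad_scale d (?u 3)"
    by (simp add: x of_vec_def quad_scale_def)
  have fx: "to_vec (f x) = a \<cdot>\<^sub>v to_vec (f (?u 0)) + b \<cdot>\<^sub>v to_vec (f (?u 1)) + c \<cdot>\<^sub>v to_vec (f (?u 2)) + d \<cdot>\<^sub>v to_vec (f (?u 3))"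
    unfolding x' by (simp add: add scale to_vec_add to_vec_scale)
  have tx: "to_vec x $ 0 = a" "to_vec x $ Suc 0 = b" "to_vec x $ 2 = c" "to_vec x $ 3 = d"
    using of_vec_to_vec[of x] unfolding x of_vec_def by simp_all
  have "std_mat f *\<^sub>v to_vec x = to_vec (f x)"
  proof (rule eq_vecI)
    fix i assume "i < dim_vec (to_vec (f x))"
    then have i: "i < 4" by simp
    have "(std_mat f *\<^sub>v to_vec x) $ i = (\<Sum>j\<in>{0..<4}. to_vec (f (?u j)) $ i * to_vec x $ j)"
      using i by (simp add: std_mat_def scalar_prod_def)
    also have "{0..<4} = {0,1,2,3::nat}" by auto
    finally show "(std_mat f *\<^sub>v to_vec x) $ i = to_vec (f x) $ i"
      unfolding fx using i by (simp add: tx ac_simps)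
  qed (simp add: std_mat_def)
  then show ?thesis by (simp add: quad_act_def)
qed

lemma char_2_of_card:
  assumes "card (UNIV :: 'a::{finite,field} set) = 2 ^ e"
  shows "(2::'a) = 0"
proof -
  have "CHAR('a) dvd 2 ^ e" using CHAR_dvd_CARD[where 'a = 'a] assms by simp
  then have "of_nat (2 ^ e) = (0::'a)" by (simp only: of_nat_eq_0_iff_char_dvd)
  then show ?thesis by simp
qed

lemma char2_symplectic_quad:
  assumes "card (UNIV :: 'a::{finite,field} set) = 2 ^ e"
  shows "char2_symplectic (Sp4 :: 'a mat monoid) quad_scale quad_act quad_form"
proof -
  have two: "(2::'a) = 0" by (rule char_2_of_card[OF assms])
  then have minus: "- c = c" for c :: 'a
    by (metis add.inverse_unique mult_2 mult_zero_left)
  have form: "quad_form (a,b,c,d) (a',b',c',d') = a * c' + b * d' + c * a' + d * b'" for a b c d a' b' c' d' :: 'a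
    unfolding quad_form_eq using minus by (metis diff_conv_add_uminus)
  have Spc: "A \<in> carrier_mat 4 4" if "A \<in> carrier Sp4" for A :: "'a mat"
    using that by (simp add: Sp4_def)
  have zero: "(0 :: 'a quad) = (0,0,0,0)" by (simp add: zero_prod_def)
  interpret G: group "Sp4 :: 'a mat monoid" by (rule group_Sp4)
  show ?thesis
  proof (intro char2_symplectic.intro char2_symplectic_axioms.intro finite_group.intro G.group_axioms
      finite_group_axioms.intro)
    show "finite (carrier (Sp4 :: 'a mat monoid))"
      by (rule finite_subset[OF _ finite_carrier_mat[of 4 4]]) (auto simp: Sp4_def)
    show "vector_space (quad_scale :: 'a \<Rightarrow> _)"
      by unfold_locales (auto simp: quad_scale_def algebra_simps)
    fix x y z :: "'a quad" and k :: 'a and A C :: "'a mat"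
    obtain x1 x2 x3 x4 y1 y2 y3 y4 z1 z2 z3 z4
      where q: "x = (x1,x2,x3,x4)" "y = (y1,y2,y3,y4)" "z = (z1,z2,z3,z4)" by (cases x; cases y; cases z) blast
    show "quad_form (x + y) z = quad_form x z + quad_form y z" by (simp add: q form algebra_simps)
    show "quad_form (quad_scale k x) y = k * quad_form x y" by (simp add: q form quad_scale_def algebra_simps)
    show "quad_form x y = quad_form y x" by (simp add: q form algebra_simps)
    show "quad_form x x = 0" by (simp add: q quad_form_eq mult.commute)
    show "x = 0" if h: "\<And>y. quad_form x y = 0"
      using h[of "(1,0,0,0)"] h[of "(0,1,0,0)"] h[of "(0,0,1,0)"] h[of "(0,0,0,1)"] by (simp add: q form zero)
    show "quad_act \<one>\<^bsub>Sp4\<^esub> x = x" by (simp add: Sp4_def quad_act_one)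
    { assume A: "A \<in> carrier Sp4"
      have Av: "A *\<^sub>v to_vec w \<in> carrier_vec 4" for w using Spc[OF A] by (meson mult_mat_vec_carrier to_vec_carrier)
      show "quad_act A (x + y) = quad_act A x + quad_act A y"
        using Spc[OF A] Av by (simp add: quad_act_def to_vec_add of_vec_add mult_add_distrib_mat_vec[of _ 4 4])
      show "quad_act A (quad_scale k x) = quad_scale k (quad_act A x)"
        using Spc[OF A] Av by (simp add: quad_act_def to_vec_scale of_vec_smult mult_mat_vec[of _ 4 4])
      show "quad_form (quad_act A x) (quad_act A y) = quad_form x y" using A Sp4_iff[OF Spc[OF A]] by blast
      show "quad_act (A \<otimes>\<^bsub>Sp4\<^esub> C) x = quad_act A (quad_act C x)" if "C \<in> carrier Sp4"
        using Spc[OF A] Spc[OF that] by (simp add: Sp4_def quad_act_mult) }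
    show "\<exists>g\<in>carrier Sp4. \<forall>x. quad_act g x = f x"
      if "\<And>x y. f (x + y) = f x + f y" "\<And>c x. f (quad_scale c x) = quad_scale c (f x)"
        "\<And>x y. quad_form (f x) (f y) = quad_form x y" for f :: "'a quad \<Rightarrow> 'a quad"
    proof -
      have "std_mat f \<in> carrier_mat 4 4" by (simp add: std_mat_def)
      then have "std_mat f \<in> carrier Sp4"
        using Sp4_iff[of "std_mat f"] that(3) unfolding quad_act_std_mat[OF that(1,2)] by blast
      then show ?thesis using quad_act_std_mat[OF that(1,2)] by blast
    qed
    show "\<exists>e1 e2 f1 f2 :: 'a quad. quad_form e1 f1 = 1 \<and> quad_form e2 f2 = 1 \<and> quad_form e1 e2 = 0 \<and>
      quad_form e1 f2 = 0 \<and> quad_form e2 f1 = 0 \<and> quad_form f1 f2 = 0 \<and>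
      (\<forall>x. x = quad_scale (quad_form x f1) e1 + quad_scale (quad_form x f2) e2 +
        quad_scale (quad_form x e1) f1 + quad_scale (quad_form x e2) f2)"
      by (rule exI[of _ "(1,0,0,0)"], rule exI[of _ "(0,1,0,0)"], rule exI[of _ "(0,0,1,0)"], rule exI[of _ "(0,0,0,1)"])
        (auto simp: form quad_scale_def)
  qed (rule two)
qed

lemma stabilizer_eq:
  assumes S: "S \<subseteq> carrier_vec 4"
  shows "stabilizer S = {A \<in> carrier Sp4. quad_act A ` of_vec ` S = of_vec ` S}"
proof -
  have "(\<lambda>x. A *\<^sub>v x) ` S = S \<longleftrightarrow> quad_act A ` of_vec ` S = of_vec ` S" if "A \<in> carrier Sp4" for A :: "'a mat"
  proof -
    have A: "A \<in> carrier_mat 4 4" using that by (simp add: Sp4_def)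
    then have AS: "(\<lambda>x. A *\<^sub>v x) ` S \<subseteq> carrier_vec 4" using S by (auto intro: mult_mat_vec_carrier)
    have inj: "inj_on of_vec (carrier_vec 4 :: 'a vec set)" by (metis inj_onI to_vec_of_vec)
    have "quad_act A ` of_vec ` S = of_vec ` (\<lambda>x. A *\<^sub>v x) ` S"
      unfolding image_image using S by (intro image_cong) (auto simp: quad_act_def)
    then show ?thesis using inj_on_image_eq_iff[OF inj AS S] by simp
  qed
  then show ?thesis unfolding stabilizer_def by blast
qed

lemma of_vec_span1:
  assumes "v \<in> carrier_vec 4"
  shows "of_vec ` span1 v = {quad_scale a (of_vec v) | a. True}"
proof -
  have "of_vec ` span1 v = {of_vec (a \<cdot>\<^sub>v v) | a. True}" unfolding span1_def by blast
  then show ?thesis unfolding of_vec_smult[OF assms] .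
qed

lemma of_vec_span2:
  assumes "u \<in> carrier_vec 4" "w \<in> carrier_vec 4"
  shows "of_vec ` span2 u w = {quad_scale a (of_vec u) + quad_scale c (of_vec w) | a c. True}"
proof -
  have "of_vec (a \<cdot>\<^sub>v u + b \<cdot>\<^sub>v w) = quad_scale a (of_vec u) + quad_scale b (of_vec w)" for a b
    using assms by (simp add: of_vec_add of_vec_smult)
  moreover have "of_vec ` span2 u w = {of_vec (a \<cdot>\<^sub>v u + b \<cdot>\<^sub>v w) | a b. True}"
    unfolding span2_def by blast
  ultimately show ?thesis by presburger
qed

theorem theorem4p1:
  fixes e :: nat and v u w :: "'a::{finite,field} vec"
  assumes "card (UNIV :: 'a set) = 2 ^ e" and "e > 2"
    and "v \<in> carrier_vec 4" and "v \<noteq> 0\<^sub>v 4"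
    and "u \<in> carrier_vec 4" and "w \<in> carrier_vec 4"
    and "\<forall>a b. a \<cdot>\<^sub>v u + b \<cdot>\<^sub>v w = 0\<^sub>v 4 \<longrightarrow> a = 0 \<and> b = 0"
    and "sform u w = 0"
  shows "\<not> strong_gelfand_pair (Sp4 :: 'a mat monoid) (stabilizer (span1 v))
       \<and> \<not> strong_gelfand_pair (Sp4 :: 'a mat monoid) (stabilizer (span2 u w))"
proof -
  \<comment> \<open>From q at least 8 the exponents 2, 3 and 4 lie below q - 1, so none of these
    powers of \<open>\<theta> t\<close> is 1.\<close>
  have "(2::nat) ^ 3 \<le> 2 ^ e" using assms(2) by (intro power_increasing) auto
  then have card: "card (UNIV :: 'a set) \<ge> 8" using assms(1) by simp
  then have card2: "card (UNIV :: 'a set) > 2" by simp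
  obtain \<theta> :: "'a \<Rightarrow> complex" and t where \<theta>: "t \<noteq> 0" "mult_character \<theta>"
    and pow: "\<forall>k>0. k < card (UNIV :: 'a set) - 1 \<longrightarrow> \<theta> t ^ k \<noteq> 1"
    using finite_field_character[where 'a = 'a, OF card2] by blast
  have \<theta>_t: "\<theta> t ^ 2 \<noteq> 1" "\<theta> t ^ 3 \<noteq> 1" "\<theta> t ^ 4 \<noteq> 1"
    using card pow[rule_format, of 2] pow[rule_format, of 3] pow[rule_format, of 4] by linarith+
  obtain \<phi> :: "'a \<Rightarrow> complex" and c where \<phi>: "\<forall>x y. \<phi> (x + y) = \<phi> x * \<phi> y" "\<phi> 0 = 1" "\<forall>x. (\<phi> x)\<^sup>2 = 1" "\<phi> c \<noteq> 1"
    using char2_additive_character[OF char_2_of_card[OF assms(1)]] by blast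
  interpret char2_symplectic_chars "Sp4 :: 'a mat monoid" quad_scale quad_act quad_form \<theta> \<phi> t c
    by (intro char2_symplectic_chars.intro char2_symplectic_quad[OF assms(1)] char2_symplectic_chars_axioms.intro
        \<theta> \<theta>_t \<phi>(2,4) \<phi>(1)[rule_format] \<phi>(3)[rule_format])
  have vec0: "of_vec (0\<^sub>v 4) = (0 :: 'a quad)" by (simp add: of_vec_def zero_prod_def)
  have inj: "x = y" if "of_vec x = of_vec y" "x \<in> carrier_vec 4" "y \<in> carrier_vec 4" for x y :: "'a vec"
    using that to_vec_of_vec by metis
  have "of_vec v \<noteq> 0" using assms(3,4) inj[of v "0\<^sub>v 4"] vec0 by auto
  \<comment> \<open>Every nonzero v is the first vector of some symplectic basis, so arbitrary lines
    are reached without appeal to transitivity of the group.\<close>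
  then obtain v' where "\<And>a b. quad_scale a (of_vec v) + quad_scale b v' = 0 \<Longrightarrow> a = 0 \<and> b = 0" "quad_form (of_vec v) v' = 0"
    using ex_orthogonal by blast
  then obtain f1 f2 where "symplectic_basis (of_vec v) v' f1 f2" by (rule ex_symplectic_basis)
  from not_strong_gelfand_pair_line[OF this]
  have "\<not> strong_gelfand_pair (Sp4 :: 'a mat monoid) (stabilizer (span1 v))"
    using stabilizer_eq[of "span1 v"] of_vec_span1[OF assms(3)] assms(3)
    unfolding set_stabilizer_def by (fastforce simp: span1_def)
  moreover have "\<not> strong_gelfand_pair (Sp4 :: 'a mat monoid) (stabilizer (span2 u w))"
  proof -
    have "a = 0 \<and> b = 0" if "quad_scale a (of_vec u) + quad_scale b (of_vec w) = 0" for a b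
    proof -
      have "of_vec (a \<cdot>\<^sub>v u + b \<cdot>\<^sub>v w) = of_vec (0\<^sub>v 4)"
        using that assms(5,6) vec0 by (simp add: of_vec_add of_vec_smult)
      then have "a \<cdot>\<^sub>v u + b \<cdot>\<^sub>v w = 0\<^sub>v 4" using assms(5,6) by (intro inj) auto
      then show ?thesis using assms(7) by blast
    qed
    moreover have "quad_form (of_vec u) (of_vec w) = 0" using assms(5,6,8) by (simp add: quad_form_def)
    ultimately obtain f1 f2 where "symplectic_basis (of_vec u) (of_vec w) f1 f2"
      by (rule ex_symplectic_basis)
    from not_strong_gelfand_pair_plane[OF this] show ?thesis
      using stabilizer_eq[of "span2 u w"] of_vec_span2[OF assms(5,6)] assms(5,6)
      unfolding set_stabilizer_def by (fastforce simp: span2_def)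
  qed
  ultimately show ?thesis ..
qed

end
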